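(* Let $\mathcal{H}$ be a real Hilbert space, let $z\in\mathcal{H}$, let $m$ be a strictly positive integer, let $(\omega_i)_{1\leq i\leq m}$ be real numbers in $]0,1]$ such that $\sum_{i=1}^m\omega_i=1$, let $A\colon\mathcal{H}\to 2^{\mathcal{H}}$ be maximally monotone, and let $C\colon\mathcal{H}\to\mathcal{H}$ be $\mu$-cocoercive for some $\mu\in\,]0,+\infty[$. For every $i\in\{1,\ldots,m\}$, let $\mathcal{G}_i$ be a real Hilbert space, let $r_i\in\mathcal{G}_i$, let $B_i\colon\mathcal{G}_i\to 2^{\mathcal{G}_i}$ be maximally monotone, let $D_i\colon\mathcal{G}_i\to 2^{\mathcal{G}_i}$ be maximally monotone and $\nu_i$-strongly monotone for some $\nu_i\in\,]0,+\infty[$, and let $L_i\colon\mathcal{H}\to\mathcal{G}_i$ be a nonzero bounded linear operator. Let $\mathcal{P}$ be the set of solutions to the primal inclusion: find $\overline{x}\in\mathcal{H}$ such that $$z\in A\overline{x}+\sum_{i=1}^m\omega_iL_i^*\big((B_i\,\square\, D_i)(L_i\overline{x}-r_i)\big)+C\overline{x},$$ and let $\mathcal{D}$ be the set of solutions to the dual inclusion: find $(\overline{v}_1,\ldots,\overline{v}_m)\in\mathcal{G}_1\times\cdots\times\mathcal{G}_m$ such that $$(\exists\, x\in\mathcal{H})\quad\begin{cases} z-\sum_{i=1}^m\omega_iL_i^*\overline{v}_i\in Ax+Cx\\ (\forall i\in\{1,\ldots,m\})\;\; \overline{v}_i\in(B_i\,\square\, D_i)(L_ix-r_i).\end{cases}$$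 Suppose that $$z\in\operatorname{ran}\Big(A+\sum_{i=1}^m\omega_iL_i^*\big((B_i\,\square\, D_i)(L_i\,\cdot-r_i)\big)+C\Big).$$ Let $\tau$ and $(\sigma_i)_{1\leq i\leq m}$ be strictly positive numbers such that $$2\rho\min\{\mu,\nu_1,\ldots,\nu_m\}>1,\quad\text{where}\quad \rho=\min\{\tau^{-1},\sigma_1^{-1},\ldots,\sigma_m^{-1}\}\Bigg(1-\sqrt{\tau\sum_{i=1}^m\sigma_i\omega_i\|L_i\|^2}\Bigg).$$ Let $\varepsilon\in\,]0,1[$, let $(\lambda_n)_{n\in\mathbb{N}}$ be a sequence in $[\varepsilon,1]$, let $x_0\in\mathcal{H}$, and let $(a_{1,n})_{n\in\mathbb{N}}$ and $(a_{2,n})_{n\in\mathbb{N}}$ be absolutely summable sequences in $\mathcal{H}$. For every $i\in\{1,\ldots,m\}$, let $v_{i,0}\in\mathcal{G}_i$, and let $(b_{i,n})_{n\in\mathbb{N}}$ and $(c_{i,n})_{n\in\mathbb{N}}$ be absolutely summable sequences in $\mathcal{G}_i$. Let $(x_n)_{n\in\mathbb{N}}$ and $(v_{1,n},\ldots,v_{m,n})_{n\in\mathbb{N}}$ be the sequences generated, for every $n\in\mathbb{N}$, by $$\begin{aligned} p_n&=J_{\tau A}\Big(x_n-\tau\Big(\sum_{i=1}^m\omega_iL_i^*v_{i,n}+Cx_n+a_{1,n}-z\Big)\Big)+a_{2,n},\\ y_n&=2p_n-x_n,\\ x_{n+1}&=x_n+\lambda_n(p_n-x_n), \end{aligned}$$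 and, for $i=1,\ldots,m$, $$\begin{aligned} q_{i,n}&=J_{\sigma_iB_i^{-1}}\Big(v_{i,n}+\sigma_i\big(L_iy_n-D_i^{-1}v_{i,n}-c_{i,n}-r_i\big)\Big)+b_{i,n},\\ v_{i,n+1}&=v_{i,n}+\lambda_n(q_{i,n}-v_{i,n}). \end{aligned}$$ Then there exist $\overline{x}\in\mathcal{P}$ and $(\overline{v}_1,\ldots,\overline{v}_m)\in\mathcal{D}$ such that the following hold. (i) $x_n\rightharpoonup\overline{x}$ and $(v_{1,n},\ldots,v_{m,n})\rightharpoonup(\overline{v}_1,\ldots,\overline{v}_m)$. (ii) If $C$ is uniformly monotone at $\overline{x}$, then $x_n\to\overline{x}$. (iii) If $D_j^{-1}$ is uniformly monotone at $\overline{v}_j$ for some $j\in\{1,\ldots,m\}$, then $v_{j,n}\to\overline{v}_j$.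
   Context: Notation: $\rightharpoonup$ and $\to$ denote weak and strong convergence, respectively; $L^*$ is the adjoint of a bounded linear operator $L$; $\operatorname{Id}$ is the identity operator. A sequence $(a_n)$ is absolutely summable if $\sum_n\|a_n\|<+\infty$. Let $\mathcal{K}$ be a real Hilbert space and let $T\colon\mathcal{K}\to2^{\mathcal{K}}$ be a set-valued operator. Its graph is $\operatorname{gra}T=\{(x,u)\mid u\in Tx\}$, its domain is $\operatorname{dom}T=\{x\mid Tx\neq\varnothing\}$, its range is $\operatorname{ran}T=\{u\mid(\exists x)\ u\in Tx\}$, its inverse is $T^{-1}\colon u\mapsto\{x\mid u\in Tx\}$, and its resolvent is $J_T=(\operatorname{Id}+T)^{-1}$ (single-valued and everywhere defined when $T$ is maximally monotone). $T$ is monotone if $\langle x-y\mid u-v\rangle\geq0$ for all $(x,u),(y,v)\in\operatorname{gra}T$, and maximally monotone if moreover there is no monotone operator whose graph properly contains $\operatorname{gra}T$. $T$ is $\alpha$-strongly monotone, with $\alpha\in\,]0,+\infty[$, if $T-\alpha\operatorname{Id}$ is monotone. $T$ is uniformly monotone at $x\in\operatorname{dom}T$ if there exists an increasing function $\phi\colon[0,+\infty[\,\to[0,+\infty]$ vanishing only at $0$ such that $\langle x-y\mid u-v\rangle\geq\phi(\|x-y\|)$ for all $u\in Tx$ and all $(y,v)\in\operatorname{gra}T$. A single-valued operator $C\colon\mathcal{K}\to\mathcal{K}$ is $\beta$-cocoercive, with $\beta\in\,]0,+\infty[$, if $\langle x-y\mid Cx-Cy\rangle\geq\beta\|Cx-Cy\|^2$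 for all $x,y\in\mathcal{K}$. The parallel sum of $T_1,T_2\colon\mathcal{K}\to2^{\mathcal{K}}$ is $T_1\,\square\,T_2=(T_1^{-1}+T_2^{-1})^{-1}$. Since each $D_i$ is maximally monotone and strongly monotone, $D_i^{-1}$ is single-valued and defined on all of $\mathcal{G}_i$, and is regarded as a map $\mathcal{G}_i\to\mathcal{G}_i$. *)

theory Defs
  imports "HOL-Analysis.Analysis"
begin

text \<open>
  A set-valued operator \<open>T : V \<rightarrow> 2\<^sup>V\<close> on a Hilbert space \<open>V\<close> is a function \<open>'a \<Rightarrow> 'a set\<close>. Here \<open>V\<close> is
  a closed linear subspace of a Hilbert space type, and an operator on \<open>V\<close> has empty values outside
  \<open>V\<close>. This lets a family of different Hilbert spaces live in a single type: any finite family
  embeds isometrically, as closed subspaces, in its Hilbert direct sum. Values of operators are added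
  with the Minkowski sum of \<^theory>\<open>HOL-Library.Set_Algebras\<close>.
\<close>

definition hilbert_subspace :: "'a::{real_inner,complete_space} set \<Rightarrow> bool" where
  "hilbert_subspace V \<longleftrightarrow> subspace V \<and> closed V"

definition gra :: "('a \<Rightarrow> 'b set) \<Rightarrow> ('a \<times> 'b) set" where
  "gra T = {(x, u). u \<in> T x}"

definition dom_op :: "('a \<Rightarrow> 'b set) \<Rightarrow> 'a set" where
  "dom_op T = {x. T x \<noteq> {}}"

definition ran_op :: "('a \<Rightarrow> 'b set) \<Rightarrow> 'b set" where
  "ran_op T = {u. \<exists>x. u \<in> T x}"

definition inv_op :: "('a \<Rightarrow> 'b set) \<Rightarrow> 'b \<Rightarrow> 'a set" where
  "inv_op T u = {x. u \<in> T x}"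

definition scale_op :: "real \<Rightarrow> ('a \<Rightarrow> 'b::real_vector set) \<Rightarrow> 'a \<Rightarrow> 'b set" where
  "scale_op c T x = (\<lambda>u. c *\<^sub>R u) ` T x"

text \<open>A single-valued operator regarded as a map; unspecified where \<open>T x\<close> is not a singleton.\<close>

definition as_map :: "('a \<Rightarrow> 'b set) \<Rightarrow> 'a \<Rightarrow> 'b" where
  "as_map T x = the_elem (T x)"

definition resolvent :: "('a::real_vector \<Rightarrow> 'a set) \<Rightarrow> 'a \<Rightarrow> 'a" where
  "resolvent T = as_map (inv_op (\<lambda>x. {x} + T x))"

definition parallel_sum :: "('a::real_vector \<Rightarrow> 'a set) \<Rightarrow> ('a \<Rightarrow> 'a set) \<Rightarrow> 'a \<Rightarrow> 'a set" where
  "parallel_sum T1 T2 = inv_op (\<lambda>u. inv_op T1 u + inv_op T2 u)"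

definition monotone_op :: "('a::real_inner \<Rightarrow> 'a set) \<Rightarrow> bool" where
  "monotone_op T \<longleftrightarrow> (\<forall>(x, u)\<in>gra T. \<forall>(y, v)\<in>gra T. (x - y) \<bullet> (u - v) \<ge> 0)"

definition maximally_monotone_on :: "'a::real_inner set \<Rightarrow> ('a \<Rightarrow> 'a set) \<Rightarrow> bool" where
  "maximally_monotone_on V T \<longleftrightarrow>
     gra T \<subseteq> V \<times> V \<and> monotone_op T \<and>
     \<not> (\<exists>S. gra S \<subseteq> V \<times> V \<and> monotone_op S \<and> gra T \<subset> gra S)"

definition strongly_monotone :: "real \<Rightarrow> ('a::real_inner \<Rightarrow> 'a set) \<Rightarrow> bool" where
  "strongly_monotone \<alpha> T \<longleftrightarrow> \<alpha> > 0 \<and> monotone_op (\<lambda>x. (\<lambda>u. u - \<alpha> *\<^sub>R x) ` T x)"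

text \<open>``Increasing'' is meant in the weak sense, \<open>s \<le> t \<Longrightarrow> \<phi> s \<le> \<phi> t\<close>.\<close>

definition uniformly_monotone_at :: "('a::real_inner \<Rightarrow> 'a set) \<Rightarrow> 'a \<Rightarrow> bool" where
  "uniformly_monotone_at T x \<longleftrightarrow>
     x \<in> dom_op T \<and>
     (\<exists>\<phi> :: real \<Rightarrow> ereal.
        (\<forall>t\<ge>0. \<phi> t \<ge> 0) \<and> mono_on {0..} \<phi> \<and> (\<forall>t\<ge>0. \<phi> t = 0 \<longleftrightarrow> t = 0) \<and>
        (\<forall>u\<in>T x. \<forall>(y, v)\<in>gra T. ereal ((x - y) \<bullet> (u - v)) \<ge> \<phi> (norm (x - y))))"

definition cocoercive :: "real \<Rightarrow> ('a::real_inner \<Rightarrow> 'a) \<Rightarrow> bool" where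
  "cocoercive \<beta> C \<longleftrightarrow> \<beta> > 0 \<and> (\<forall>x y. (x - y) \<bullet> (C x - C y) \<ge> \<beta> * (norm (C x - C y))\<^sup>2)"

definition weakly_converges_in :: "'a::real_inner set \<Rightarrow> (nat \<Rightarrow> 'a) \<Rightarrow> 'a \<Rightarrow> bool" where
  "weakly_converges_in V x l \<longleftrightarrow> (\<forall>u\<in>V. (\<lambda>n. x n \<bullet> u) \<longlonglongrightarrow> l \<bullet> u)"

text \<open>
  The index set \<open>{1,\<dots>,m}\<close> is a finite type \<open>'i\<close>, and \<open>G\<^sub>1 \<times> \<dots> \<times> G\<^sub>m\<close> is a closed subspace of the
  Hilbert space \<open>'g ^ 'i\<close>, whose inner product is the sum of the componentwise ones.
\<close>

definition prod_space :: "('i::finite \<Rightarrow> 'g set) \<Rightarrow> ('g ^ 'i) set" where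
  "prod_space G = {v. \<forall>i. v $ i \<in> G i}"

text \<open>
  For a bounded linear \<open>L : 'h \<Rightarrow> 'g\<close> with range in a closed subspace \<open>V\<close>, the adjoint of \<open>L : 'h \<rightarrow> V\<close>
  is the restriction of \<open>adjoint L\<close> to \<open>V\<close>; below it is only applied to elements of \<open>V\<close>.
\<close>

definition primal_op ::
  "('h::real_inner \<Rightarrow> 'h set) \<Rightarrow> ('h \<Rightarrow> 'h) \<Rightarrow> ('i::finite \<Rightarrow> real) \<Rightarrow> ('i \<Rightarrow> 'h \<Rightarrow> 'g::real_inner) \<Rightarrow>
   ('i \<Rightarrow> 'g \<Rightarrow> 'g set) \<Rightarrow> ('i \<Rightarrow> 'g \<Rightarrow> 'g set) \<Rightarrow> ('i \<Rightarrow> 'g) \<Rightarrow> 'h \<Rightarrow> 'h set" where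
  "primal_op A C \<omega> L B D r x =
     A x
     + (\<Sum>i\<in>UNIV. (\<lambda>v. \<omega> i *\<^sub>R adjoint (L i) v) ` parallel_sum (B i) (D i) (L i x - r i))
     + {C x}"

definition primal_solutions ::
  "'h::real_inner \<Rightarrow> ('h \<Rightarrow> 'h set) \<Rightarrow> ('h \<Rightarrow> 'h) \<Rightarrow> ('i::finite \<Rightarrow> real) \<Rightarrow>
   ('i \<Rightarrow> 'h \<Rightarrow> 'g::real_inner) \<Rightarrow> ('i \<Rightarrow> 'g \<Rightarrow> 'g set) \<Rightarrow> ('i \<Rightarrow> 'g \<Rightarrow> 'g set) \<Rightarrow> ('i \<Rightarrow> 'g) \<Rightarrow> 'h set" where
  "primal_solutions z A C \<omega> L B D r = {x. z \<in> primal_op A C \<omega> L B D r x}"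

definition dual_solutions ::
  "'h::real_inner \<Rightarrow> ('h \<Rightarrow> 'h set) \<Rightarrow> ('h \<Rightarrow> 'h) \<Rightarrow> ('i::finite \<Rightarrow> 'g::real_inner set) \<Rightarrow>
   ('i \<Rightarrow> real) \<Rightarrow> ('i \<Rightarrow> 'h \<Rightarrow> 'g) \<Rightarrow> ('i \<Rightarrow> 'g \<Rightarrow> 'g set) \<Rightarrow> ('i \<Rightarrow> 'g \<Rightarrow> 'g set) \<Rightarrow> ('i \<Rightarrow> 'g) \<Rightarrow>
   ('g ^ 'i) set" where
  "dual_solutions z A C G \<omega> L B D r =
     {v \<in> prod_space G.
        \<exists>x. z - (\<Sum>i\<in>UNIV. \<omega> i *\<^sub>R adjoint (L i) (v $ i)) \<in> A x + {C x} \<and>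
            (\<forall>i. v $ i \<in> parallel_sum (B i) (D i) (L i x - r i))}"

end

theory Submission
  imports Defs
begin

text \<open>
  The algorithm is a perturbed, relaxed forward-backward iteration in disguise. On the product space
  of the pairs \<open>(x, v)\<close>, the two resolvent steps together solve one inclusion
  \<open>P (u - T u) - F u \<in> M (T u)\<close>: the operator \<open>F (x, v) = (C x, D\<^sub>1\<inverse> v\<^sub>1, \<dots>)\<close> is cocoercive, \<open>M\<close> is
  the monotone operator built from \<open>A\<close>, the \<open>B\<^sub>i\<inverse>\<close> and the skew coupling given by the \<open>L\<^sub>i\<close>
  and their adjoints, and \<open>P\<close> is the self-adjoint preconditioner
  \<open>(x, v) \<mapsto> (x / \<tau> - \<Sum> \<omega>\<^sub>i L\<^sub>i\<^sup>* v\<^sub>i, v\<^sub>i / \<sigma>\<^sub>i - L\<^sub>i x)\<close>. The extrapolation \<open>y = 2 p - x\<close> is exactly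
  what makes \<open>P\<close> symmetric. The condition on the step sizes makes the form \<open>Q\<close> of \<open>P\<close> dominate \<open>\<rho>\<close>
  times the weighted inner product \<open>W\<close>. So \<open>Q\<close> is an equivalent inner product, and the geometry of
  the iteration is that of \<open>Q\<close>.

  In this geometry \<open>T\<close> is averaged. Monotonicity of \<open>A\<close> and \<open>B\<^sub>i\<close> gives \<open>T_monotone\<close>; combined with
  cocoercivity of \<open>F\<close> and Young's inequality with a parameter strictly between \<open>1 / (2 \<rho>)\<close> and \<open>\<beta>\<close>,
  which exists because \<open>2 \<rho> \<beta> > 1\<close>, it gives \<open>T_averaged\<close>: the squared \<open>Q\<close>-distance decreases by a
  multiple of the squared residual plus a multiple of \<open>\<parallel>F u - F w\<parallel>\<^sup>2\<close>. The fixed points of \<open>T\<close> are the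
  primal-dual solutions (\<open>fixed_point_iff\<close>).

  Weak convergence follows as usual for averaged maps (\<open>averaged_iteration_converges\<close>). The distances to
  every fixed point converge, since the errors are summable; the residuals and the terms
  \<open>F u\<^sub>n - F l\<close> tend to zero; weak cluster points are fixed points by demiclosedness; and there is only one
  of them by Opial's argument. Strong convergence costs nothing more: as \<open>C x\<^sub>n \<rightarrow> C l\<close> strongly and
  \<open>x\<^sub>n\<close> is bounded, \<open>\<langle>l - x\<^sub>n, C l - C x\<^sub>n\<rangle> \<rightarrow> 0\<close>, and uniform monotonicity turns this into
  \<open>x\<^sub>n \<rightarrow> l\<close>; the same works for each \<open>D\<^sub>j\<inverse>\<close>.

  The Hilbert space background is developed on the way: the Riesz theorem, weak compactness of balls in
  the form of convergence along a finer filter, and Minty's surjectivity theorem. The Riesz and Minty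
  theorems rest on one principle, \<open>minimizing_sequence\<close>.
\<close>

section \<open>Auxiliary facts about real sequences, norms and inner products\<close>

text \<open>
  The midpoint inequality makes every minimizing sequence Cauchy, with no compactness: two almost
  minimal points whose images under \<open>\<pi>\<close> are far apart would have a midpoint below the infimum. The image
  under \<open>\<pi>\<close> is kept separate from the point because, in the proof of Minty's theorem, the points carry
  further coordinates that need not converge.
\<close>

lemma minimizing_sequence:
  fixes q :: "'s \<Rightarrow> real" and \<pi> :: "'s \<Rightarrow> 'a::{real_normed_vector,complete_space}"
  assumes ne: "S \<noteq> {}" and bd: "\<And>a. a \<in> S \<Longrightarrow> \<beta> \<le> q a" and k: "k > 0"
    and mid: "\<And>a b. a \<in> S \<Longrightarrow> b \<in> S \<Longrightarrow>
                \<exists>c\<in>S. q c + k * (norm (\<pi> a - \<pi> b))\<^sup>2 \<le> (q a + q b) / 2"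
  obtains a l I where "\<And>n::nat. a n \<in> S" "\<And>s. s \<in> S \<Longrightarrow> I \<le> q s"
    "(\<lambda>n. q (a n)) \<longlonglongrightarrow> I" "(\<lambda>n. \<pi> (a n)) \<longlonglongrightarrow> l"
proof -
  define I where "I = Inf (q ` S)"
  have bb: "bdd_below (q ` S)" using bd by (rule bdd_belowI2)
  have low: "I \<le> q s" if "s \<in> S" for s
    unfolding I_def using bb that by (rule cINF_lower)
  have "\<exists>s\<in>S. q s < I + inverse (real (Suc n))" for n
    using cINF_less_iff[OF ne bb, of "I + inverse (real (Suc n))"] unfolding I_def
    by (simp add: add_pos_pos)
  then obtain a where a: "\<And>n. a n \<in> S" "\<And>n. q (a n) < I + inverse (real (Suc n))" by metis
  have lim: "(\<lambda>n. q (a n)) \<longlonglongrightarrow> I"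
  proof (rule tendsto_sandwich[of "\<lambda>_. I" _ _ "\<lambda>n. I + inverse (real (Suc n))"])
    show "(\<lambda>n. I + inverse (real (Suc n))) \<longlonglongrightarrow> I" by (rule LIMSEQ_inverse_real_of_nat_add)
  qed (use low a(1) less_imp_le[OF a(2)] in \<open>auto simp del: of_nat_Suc intro!: always_eventually\<close>)
  have "Cauchy (\<lambda>n. \<pi> (a n))"
  proof (rule metric_CauchyI)
    fix e :: real assume e: "e > 0"
    then obtain N where N: "inverse (real (Suc N)) < k * e\<^sup>2"
      using reals_Archimedean[of "k * e\<^sup>2"] k by auto
    have "dist (\<pi> (a i)) (\<pi> (a j)) < e" if "i \<ge> N" "j \<ge> N" for i j
    proof -
      obtain c where c: "c \<in> S" "q c + k * (norm (\<pi> (a i) - \<pi> (a j)))\<^sup>2 \<le> (q (a i) + q (a j)) / 2"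
        using mid a(1) by blast
      have "inverse (real (Suc i)) \<le> inverse (real (Suc N))" "inverse (real (Suc j)) \<le> inverse (real (Suc N))"
        using that by (auto intro!: le_imp_inverse_le)
      then have "k * (norm (\<pi> (a i) - \<pi> (a j)))\<^sup>2 < k * e\<^sup>2"
        using c low[of c] a(2)[of i] a(2)[of j] N by argo
      then have "(norm (\<pi> (a i) - \<pi> (a j)))\<^sup>2 < e\<^sup>2" using k by simp
      then show ?thesis using e by (simp add: dist_norm power2_less_imp_less)
    qed
    then show "\<exists>N. \<forall>i\<ge>N. \<forall>j\<ge>N. dist (\<pi> (a i)) (\<pi> (a j)) < e" by blast
  qed
  then obtain l where "(\<lambda>n. \<pi> (a n)) \<longlonglongrightarrow> l" using Cauchy_convergent_iff convergent_def by blast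
  then show thesis using that a(1) low lim by blast
qed

lemma quadratic_nonneg_imp_zero:
  fixes a b :: real
  assumes "\<And>t. 0 \<le> t * a + t\<^sup>2 * b"
  shows "a = 0"
proof (rule ccontr)
  assume a: "a \<noteq> 0"
  define t where "t = - a / (1 + \<bar>b\<bar>)"
  have p: "1 + \<bar>b\<bar> > 0" by simp
  have "t\<^sup>2 * b \<le> t\<^sup>2 * \<bar>b\<bar>" by (simp add: mult_left_mono)
  also have "t\<^sup>2 * \<bar>b\<bar> < t\<^sup>2 * (1 + \<bar>b\<bar>)" using a p by (simp add: t_def)
  also have "\<dots> = t * (t * (1 + \<bar>b\<bar>))" by (simp add: power2_eq_square)
  also have "t * (1 + \<bar>b\<bar>) = - a" using p by (simp add: t_def)
  finally show False using assms[of t] by simp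
qed

lemma quasi_decreasing_convergent:
  fixes s e :: "nat \<Rightarrow> real"
  assumes nonneg: "\<And>n. 0 \<le> s n" and step: "\<And>n. s (Suc n) \<le> s n + e n"
    and e: "\<And>n. 0 \<le> e n" "summable e"
  shows "convergent s"
proof -
  define d where "d n = s n - (\<Sum>k<n. e k)" for n
  have "decseq d" using step by (auto simp: decseq_Suc_iff d_def algebra_simps)
  moreover have "- suminf e \<le> d n" for n
    using sum_le_suminf[OF e(2), of "{..<n}"] e(1) nonneg[of n] by (simp add: d_def)
  ultimately obtain L where "d \<longlonglongrightarrow> L" using decseq_convergent by blast
  then have "(\<lambda>n. d n + (\<Sum>k<n. e k)) \<longlonglongrightarrow> L + suminf e"
    using summable_LIMSEQ[OF e(2)] by (rule tendsto_add)
  then show ?thesis by (auto simp: d_def convergent_def)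
qed

lemma bounded_inner_tendsto_0:
  fixes a b :: "nat \<Rightarrow> 'b::real_inner"
  assumes "bounded (range a)" and b: "(\<lambda>n. norm (b n)) \<longlonglongrightarrow> 0"
  shows "(\<lambda>n. a n \<bullet> b n) \<longlonglongrightarrow> 0"
proof -
  obtain M where M: "\<And>n. norm (a n) \<le> M" using assms(1) by (auto simp: bounded_iff)
  have "norm (a n \<bullet> b n) \<le> M * norm (b n)" for n
  proof -
    have "\<bar>a n \<bullet> b n\<bar> \<le> norm (a n) * norm (b n)" by (rule Cauchy_Schwarz_ineq2)
    also have "\<dots> \<le> M * norm (b n)" using M by (intro mult_right_mono) auto
    finally show ?thesis by simp
  qed
  then show ?thesis
    by (intro Lim_null_comparison[OF always_eventually tendsto_mult_right_zero[OF b, of M]]) simp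
qed

lemma norm_proj_le: "norm (fst u) \<le> norm u" "norm (snd u) \<le> norm u"
  by (metis norm_fst_le norm_snd_le prod.collapse)+

lemma norm_pair_sq: "(norm (u :: 'a::real_inner \<times> 'b::real_inner))\<^sup>2 = (norm (fst u))\<^sup>2 + (norm (snd u))\<^sup>2"
  by (simp add: norm_prod_def)

lemma norm_vec_sq: "(norm (v :: 'b::real_inner ^ 'i::finite))\<^sup>2 = (\<Sum>i\<in>UNIV. (norm (v $ i))\<^sup>2)"
  by (simp add: norm_vec_def L2_set_def sum_nonneg)

lemma inner_Young:
  assumes "k > 0"
  shows "a \<bullet> b \<le> k * (norm a)\<^sup>2 + (norm b)\<^sup>2 / (4 * k)"
proof -
  have "0 \<le> (2 * k * norm a - norm b)\<^sup>2 / (4 * k)" using assms by simp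
  also have "\<dots> = k * (norm a)\<^sup>2 + (norm b)\<^sup>2 / (4 * k) - norm a * norm b"
    using assms by (simp add: field_simps power2_eq_square)
  finally show ?thesis using norm_cauchy_schwarz[of a b] by linarith
qed

section \<open>Hilbert space geometry of an equivalent inner product\<close>

text \<open>
  A symmetric form equivalent to the given norm makes the type a Hilbert space under a second inner
  product. The preconditioned iteration contracts only in such a product, which depends on the
  parameters of the problem and therefore cannot be the canonical one of the type. Weak limits and
  representers are taken in the closed subspace \<open>V\<close>, the actual space of the problem.
\<close>

locale hilbert_form =
  fixes V :: "'a::{real_normed_vector,complete_space} set" and Q :: "'a \<Rightarrow> 'a \<Rightarrow> real"
    and m M :: real
  assumes sub: "subspace V" and closed: "closed V"
    and sym: "Q a b = Q b a" and add: "Q (a + b) c = Q a c + Q b c"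
    and scale: "Q (s *\<^sub>R a) c = s * Q a c"
    and m: "m > 0" and lower: "m * (norm a)\<^sup>2 \<le> Q a a" and upper: "Q a a \<le> M * (norm a)\<^sup>2"
begin

lemma add_right: "Q a (b + c) = Q a b + Q a c"
  by (metis add sym)

lemma scale_right: "Q a (s *\<^sub>R c) = s * Q a c"
  by (metis scale sym)

lemma nonneg: "0 \<le> Q a a"
  using lower[of a] m by (meson mult_nonneg_nonneg less_imp_le order_trans zero_le_power2)

lemma Cauchy_Schwarz: "\<bar>Q a b\<bar> \<le> sqrt (Q a a) * sqrt (Q b b)"
proof -
  have *: "0 \<le> Q a a - 2 * t * Q a b + t\<^sup>2 * Q b b" for t
  proof -
    have "Q (a + (- t) *\<^sub>R b) (a + (- t) *\<^sub>R b) = Q a a - 2 * t * Q a b + t\<^sup>2 * Q b b"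
      by (simp add: add scale add_right scale_right sym[of b a]
          algebra_simps power2_eq_square del: scaleR_minus_left)
    then show ?thesis using nonneg by metis
  qed
  have "(Q a b)\<^sup>2 \<le> Q a a * Q b b"
  proof (cases "Q b b = 0")
    case True
    have "Q b b \<ge> m * (norm b)\<^sup>2" by (rule lower)
    with True m have "b = 0" by (simp add: mult_le_0_iff)
    then show ?thesis using scale[of 0 0 a] scale[of 0 0 0] sym[of a 0] by simp
  next
    case False
    then have "Q b b > 0" using nonneg[of b] by simp
    then show ?thesis using *[of "Q a b / Q b b"] by (simp add: field_simps power2_eq_square)
  qed
  then show ?thesis
    by (metis real_sqrt_abs real_sqrt_le_mono real_sqrt_mult)
qed

lemma M_nonneg: "0 \<le> M" if "a \<noteq> 0" for a :: 'a
proof -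
  have "0 \<le> M * (norm a)\<^sup>2" using upper nonneg order_trans by blast
  then show ?thesis using that by (simp add: zero_le_mult_iff)
qed

lemma bounded: "\<bar>Q a b\<bar> \<le> norm a * norm b * M"
proof (cases "a = 0 \<or> b = 0")
  case True
  then show ?thesis using scale[of 0 0 b] scale[of 0 0 a] sym[of a 0] by auto
next
  case False
  then have M: "M \<ge> 0" using M_nonneg by blast
  have s: "sqrt (Q c c) \<le> sqrt M * norm c" for c
    using real_sqrt_le_mono[OF upper[of c]] M by (simp add: real_sqrt_mult)
  have "sqrt (Q a a) * sqrt (Q b b) \<le> (sqrt M * norm a) * (sqrt M * norm b)"
    using s[of a] s[of b] M nonneg by (intro mult_mono) auto
  also have "\<dots> = norm a * norm b * M" using M by (simp add: mult.assoc mult.left_commute)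
  finally show ?thesis using Cauchy_Schwarz[of a b] by simp
qed

sublocale bil: bounded_bilinear Q
proof
  show "\<exists>K. \<forall>a b. norm (Q a b) \<le> norm a * norm b * K" using bounded by auto
qed (simp_all add: add scale add_right scale_right)

lemmas Q_simps = bil.add_left bil.add_right bil.diff_left bil.diff_right
  bil.scaleR_left bil.scaleR_right bil.minus_left bil.minus_right

definition nrm :: "'a \<Rightarrow> real" where "nrm a = sqrt (Q a a)"

lemma nrm_nonneg [simp]: "0 \<le> nrm a" by (simp add: nrm_def nonneg)

lemma nrm_sq: "(nrm a)\<^sup>2 = Q a a" by (simp add: nrm_def nonneg)

lemma nrm_triangle: "nrm (a + b) \<le> nrm a + nrm b"
proof (rule power2_le_imp_le)
  show "(nrm (a + b))\<^sup>2 \<le> (nrm a + nrm b)\<^sup>2"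
    using Cauchy_Schwarz[of a b] by (simp add: nrm_sq power2_sum Q_simps sym[of b a]) (simp add: nrm_def)
qed simp

lemma nrm_upper: "nrm a \<le> sqrt \<bar>M\<bar> * norm a"
proof -
  have "Q a a \<le> \<bar>M\<bar> * (norm a)\<^sup>2" 
    using upper[of a] by (meson abs_ge_self mult_right_mono order_trans zero_le_power2)
  then show ?thesis using real_sqrt_le_mono by (fastforce simp: nrm_def real_sqrt_mult)
qed

lemma norm_upper: "norm a \<le> nrm a / sqrt m"
proof -
  have "sqrt m * norm a \<le> nrm a"
    using real_sqrt_le_mono[OF lower[of a]] m by (simp add: nrm_def real_sqrt_mult)
  then show ?thesis using m by (simp add: field_simps)
qed

lemma midpoint: "Q ((1/2) *\<^sub>R (a + b)) ((1/2) *\<^sub>R (a + b)) = (Q a a + Q b b) / 2 - Q (a - b) (a - b) / 4"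
  by (simp add: Q_simps sym[of b a] field_simps)

lemma convex_bound:
  assumes "0 \<le> s" "s \<le> 1"
  shows "Q ((1 - s) *\<^sub>R a + s *\<^sub>R b) ((1 - s) *\<^sub>R a + s *\<^sub>R b) \<le> (1 - s) * Q a a + s * Q b b"
proof -
  have "(1 - s) * Q a a + s * Q b b - Q ((1 - s) *\<^sub>R a + s *\<^sub>R b) ((1 - s) *\<^sub>R a + s *\<^sub>R b)
      = s * (1 - s) * Q (a - b) (a - b)"
    by (simp add: Q_simps sym[of b a] algebra_simps power2_eq_square)
  moreover have "0 \<le> s * (1 - s) * Q (a - b) (a - b)" using assms nonneg by simp
  ultimately show ?thesis by linarith
qed

text \<open>
  Riesz representation, in the subspace and for the form \<open>Q\<close>: the representer of \<open>f\<close> is the minimizer of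
  \<open>x \<mapsto> Q x x - 2 f x\<close>.
\<close>

lemma representation:
  assumes f_add: "\<And>x y. x \<in> V \<Longrightarrow> y \<in> V \<Longrightarrow> f (x + y) = f x + f y"
    and f_scale: "\<And>s x. x \<in> V \<Longrightarrow> f (s *\<^sub>R x) = s * f x"
    and f_bound: "\<And>x. x \<in> V \<Longrightarrow> \<bar>f x\<bar> \<le> K * norm x"
  obtains w where "w \<in> V" "\<And>x. x \<in> V \<Longrightarrow> Q w x = f x"
proof -
  define J where "J x = Q x x - 2 * f x" for x
  have J_low: "- (K\<^sup>2 / m) \<le> J x" if "x \<in> V" for x
  proof -
    have "0 \<le> (m * norm x - K)\<^sup>2 / m" using m by simp
    also have "\<dots> = m * (norm x)\<^sup>2 - 2 * (K * norm x) + K\<^sup>2 / m"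
      using m by (simp add: field_simps power2_eq_square)
    finally show ?thesis using lower[of x] f_bound[OF that] unfolding J_def by linarith
  qed
  have mid: "\<exists>c\<in>V. J c + m / 4 * (norm (a - b))\<^sup>2 \<le> (J a + J b) / 2" if "a \<in> V" "b \<in> V" for a b
  proof (rule bexI)
    show "(1/2) *\<^sub>R (a + b) \<in> V" using that sub by (simp add: subspace_add subspace_scale)
    have "f ((1/2) *\<^sub>R (a + b)) = (f a + f b) / 2"
      using that sub by (simp add: f_scale f_add subspace_add)
    then show "J ((1/2) *\<^sub>R (a + b)) + m / 4 * (norm (a - b))\<^sup>2 \<le> (J a + J b) / 2"
      using lower[of "a - b"] midpoint[of a b] unfolding J_def by argo
  qed
  obtain a l I where a: "\<And>n::nat. a n \<in> V" and I: "\<And>s. s \<in> V \<Longrightarrow> I \<le> J s"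
    and lim: "(\<lambda>n. J (a n)) \<longlonglongrightarrow> I" "a \<longlonglongrightarrow> l"
    using minimizing_sequence[of V "- (K\<^sup>2 / m)" J "m / 4" "\<lambda>x. x"] J_low mid m sub subspace_0
    by (metis divide_pos_pos empty_iff zero_less_numeral)
  have l: "l \<in> V" using closed a lim(2) closed_sequentially by blast
  have "Q l h = f h" if h: "h \<in> V" for h
  proof -
    have "0 \<le> t * (2 * (Q l h - f h)) + t\<^sup>2 * Q h h" for t
    proof -
      have "I \<le> J (a n) + (t * (2 * (Q (a n) h - f h)) + t\<^sup>2 * Q h h)" for n
      proof -
        have "a n + t *\<^sub>R h \<in> V" using a h sub by (simp add: subspace_add subspace_scale)
        moreover have "J (a n + t *\<^sub>R h) = J (a n) + (t * (2 * (Q (a n) h - f h)) + t\<^sup>2 * Q h h)"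
          using a h sub unfolding J_def
          by (simp add: f_add f_scale subspace_scale Q_simps sym[of h "a n"] algebra_simps power2_eq_square)
        ultimately show ?thesis using I by metis
      qed
      moreover have "(\<lambda>n. J (a n) + (t * (2 * (Q (a n) h - f h)) + t\<^sup>2 * Q h h))
          \<longlonglongrightarrow> I + (t * (2 * (Q l h - f h)) + t\<^sup>2 * Q h h)"
        by (intro tendsto_intros lim bil.tendsto)
      ultimately have "I \<le> I + (t * (2 * (Q l h - f h)) + t\<^sup>2 * Q h h)"
        by (meson LIMSEQ_le_const)
      then show ?thesis by simp
    qed
    then have "2 * (Q l h - f h) = 0" by (rule quadratic_nonneg_imp_zero)
    then show ?thesis by simp
  qed
  then show thesis using that l by blast
qed

text \<open>
  Weak compactness of balls, for arbitrary filters: the functionals \<open>Q (u n)\<close> live in a product of compact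
  intervals, so Tychonoff's theorem gives a cluster point, which is again linear and bounded, hence
  represented by a vector. Passing to a finer filter plays the role of passing to a subsequence.
\<close>

lemma weak_cluster_point:
  assumes F0: "F0 \<noteq> bot" and bd: "\<And>n. norm (u n) \<le> K"
  obtains F l where "F \<le> F0" "F \<noteq> bot" "l \<in> V"
    "\<And>w. w \<in> V \<Longrightarrow> ((\<lambda>n. Q (u n) w) \<longlongrightarrow> Q l w) F"
proof -
  define \<Phi> where "\<Phi> n w = Q (u n) w" for n w
  define S where "S w = {- (K * norm w * \<bar>M\<bar>) .. K * norm w * \<bar>M\<bar>}" for w :: 'a
  have "\<bar>Q (u n) w\<bar> \<le> K * norm w * \<bar>M\<bar>" for n w
  proof -
    have "\<bar>Q (u n) w\<bar> \<le> norm (u n) * norm w * M" by (rule bounded)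
    also have "\<dots> \<le> norm (u n) * norm w * \<bar>M\<bar>" by (intro mult_left_mono) auto
    also have "\<dots> \<le> K * norm w * \<bar>M\<bar>" using bd by (intro mult_right_mono) auto
    finally show ?thesis .
  qed
  then have mem: "\<Phi> n \<in> PiE UNIV S" for n
    by (auto simp: \<Phi>_def S_def abs_le_iff minus_le_iff)
  have "compactin (product_topology (\<lambda>_. euclidean) UNIV) (PiE UNIV S)"
    by (simp add: compactin_PiE S_def)
  then have "compact (PiE UNIV S)" by (simp add: euclidean_product_topology)
  moreover have "filtermap \<Phi> F0 \<noteq> bot" "eventually (\<lambda>f. f \<in> PiE UNIV S) (filtermap \<Phi> F0)"
    using F0 mem by (auto simp: filtermap_bot_iff eventually_filtermap)
  ultimately obtain \<phi> where \<phi>: "\<phi> \<in> PiE UNIV S" "inf (nhds \<phi>) (filtermap \<Phi> F0) \<noteq> bot"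
    unfolding compact_filter by blast
  define F where "F = inf (filtercomap \<Phi> (nhds \<phi>)) F0"
  have F: "F \<noteq> bot"
  proof
    assume "F = bot"
    then have "eventually (\<lambda>_. False) F" by simp
    then obtain P R where P: "eventually P (nhds \<phi>)" and R: "eventually R F0"
      and PR: "\<And>n. P (\<Phi> n) \<Longrightarrow> R n \<Longrightarrow> False"
      unfolding F_def eventually_inf eventually_filtercomap by blast
    have "eventually (\<lambda>f. \<not> P f) (filtermap \<Phi> F0)"
      unfolding eventually_filtermap using R by eventually_elim (use PR in blast)
    then have "eventually (\<lambda>_. False) (inf (nhds \<phi>) (filtermap \<Phi> F0))"
      unfolding eventually_inf using P by blast
    then show False using \<phi>(2) by (simp add: trivial_limit_def)
  qed
  have "filterlim \<Phi> (nhds \<phi>) F" unfolding F_def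
    by (rule filterlim_mono[OF filterlim_filtercomap order_refl inf_le1])
  have lim: "((\<lambda>n. Q (u n) w) \<longlongrightarrow> \<phi> w) F" for w
    using continuous_on_tendsto_compose[OF continuous_on_product_coordinates[of w]
        \<open>filterlim \<Phi> (nhds \<phi>) F\<close>] by (simp add: \<Phi>_def)
  have "\<phi> (v + w) = \<phi> v + \<phi> w" for v w
    using tendsto_unique[OF F lim[of "v + w"]] tendsto_add[OF lim[of v] lim[of w]]
    by (simp add: bil.add_right)
  moreover have "\<phi> (s *\<^sub>R w) = s * \<phi> w" for s w
    using tendsto_unique[OF F lim[of "s *\<^sub>R w"]] tendsto_mult_left[OF lim[of w], of s]
    by (simp add: bil.scaleR_right)
  moreover have "\<bar>\<phi> w\<bar> \<le> (K * \<bar>M\<bar>) * norm w" for w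
  proof -
    have "\<phi> w \<in> S w" using \<phi>(1) by auto
    then show ?thesis by (auto simp: S_def abs_le_iff mult.commute mult.left_commute)
  qed
  ultimately obtain l where "l \<in> V" "\<And>w. w \<in> V \<Longrightarrow> Q l w = \<phi> w"
    using representation[of \<phi> "K * \<bar>M\<bar>"] by blast
  then show thesis using that[of F l] F lim by (simp add: F_def)
qed

text \<open>
  Opial's lemma. If \<open>l\<close> and \<open>l'\<close> are weak cluster points in \<open>Z\<close>, the difference of the squared distances to
  them is affine in \<open>u n\<close> and converges, so \<open>Q (u n) (l - l')\<close> converges; evaluating the limit along both
  filters gives \<open>l = l'\<close>. A bounded sequence with a single weak cluster point converges weakly.
\<close>

lemma weakly_convergent_of_bounded:
  assumes bd: "\<And>n. norm (u n) \<le> K"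
    and cluster: "\<And>F l. F \<le> sequentially \<Longrightarrow> F \<noteq> bot \<Longrightarrow> l \<in> V \<Longrightarrow>
        (\<And>w. w \<in> V \<Longrightarrow> ((\<lambda>n. Q (u n) w) \<longlongrightarrow> Q l w) F) \<Longrightarrow> l \<in> Z"
    and conv: "\<And>z. z \<in> Z \<Longrightarrow> convergent (\<lambda>n. Q (u n - z) (u n - z))"
  obtains l where "l \<in> V" "l \<in> Z" "\<And>w. w \<in> V \<Longrightarrow> (\<lambda>n. Q (u n) w) \<longlonglongrightarrow> Q l w"
proof -
  obtain F1 l where F1: "F1 \<le> sequentially" "F1 \<noteq> bot" and l: "l \<in> V"
    and lim1: "\<And>w. w \<in> V \<Longrightarrow> ((\<lambda>n. Q (u n) w) \<longlongrightarrow> Q l w) F1"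
    using weak_cluster_point[of sequentially u K] bd by auto
  have lZ: "l \<in> Z" using cluster F1 l lim1 by blast
  have uniq: "l' = l" if F2: "F2 \<le> sequentially" "F2 \<noteq> bot" and l': "l' \<in> V"
    and lim2: "\<And>w. w \<in> V \<Longrightarrow> ((\<lambda>n. Q (u n) w) \<longlongrightarrow> Q l' w) F2" for F2 l'
  proof -
    have l'Z: "l' \<in> Z" using cluster F2 l' lim2 by blast
    obtain c where c: "(\<lambda>n. Q (u n - l') (u n - l') - Q (u n - l) (u n - l)) \<longlonglongrightarrow> c"
      using convergent_diff[OF conv[OF l'Z] conv[OF lZ]] by (auto simp: convergent_def)
    have eq: "Q (u n - l') (u n - l') - Q (u n - l) (u n - l)
        = 2 * Q (u n) (l - l') + (Q l' l' - Q l l)" for n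
      by (simp add: Q_simps sym[of l "u n"] sym[of l' "u n"])
    have d: "l - l' \<in> V" using l l' sub by (simp add: subspace_diff)
    have 1: "c = 2 * Q l (l - l') + (Q l' l' - Q l l)"
      using tendsto_unique[OF F1(2) tendsto_mono[OF F1(1) c]]
        tendsto_add[OF tendsto_mult_left[OF lim1[OF d], of 2] tendsto_const] by (simp add: eq)
    have 2: "c = 2 * Q l' (l - l') + (Q l' l' - Q l l)"
      using tendsto_unique[OF F2(2) tendsto_mono[OF F2(1) c]]
        tendsto_add[OF tendsto_mult_left[OF lim2[OF d], of 2] tendsto_const] by (simp add: eq)
    from 1 2 have "Q (l - l') (l - l') = 0" by (simp add: Q_simps)
    then show ?thesis using lower[of "l - l'"] m by (simp add: mult_le_0_iff)
  qed
  have "(\<lambda>n. Q (u n) w) \<longlonglongrightarrow> Q l w" if w: "w \<in> V" for w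
  proof (rule ccontr)
    assume "\<not> ?thesis"
    then obtain r where r: "r > 0" and nev: "\<not> eventually (\<lambda>n. dist (Q (u n) w) (Q l w) < r) sequentially"
      unfolding tendsto_iff by blast
    \<comment> \<open>If convergence failed at \<open>w\<close>, some cluster point would stay away from \<open>l\<close> in direction \<open>w\<close>.\<close>
    define F0 where "F0 = inf sequentially (principal {n. dist (Q (u n) w) (Q l w) \<ge> r})"
    have "F0 \<noteq> bot" using nev
      by (simp add: F0_def trivial_limit_def eventually_inf_principal not_le)
    then obtain F2 l' where F2: "F2 \<le> F0" "F2 \<noteq> bot" and l': "l' \<in> V"
      and lim2: "\<And>w. w \<in> V \<Longrightarrow> ((\<lambda>n. Q (u n) w) \<longlongrightarrow> Q l' w) F2"
      using weak_cluster_point[of F0 u K] bd by blast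
    have "F2 \<le> sequentially" using F2(1) by (simp add: F0_def)
    then have "l' = l" using uniq F2 l' lim2 by blast
    then have "eventually (\<lambda>n. dist (Q (u n) w) (Q l w) < r) F2"
      using lim2[OF w] r unfolding tendsto_iff by blast
    moreover have "eventually (\<lambda>n. dist (Q (u n) w) (Q l w) \<ge> r) F2"
      by (rule filter_leD[OF F2(1)]) (simp add: F0_def eventually_inf_principal)
    ultimately have "eventually (\<lambda>_. False) F2" by eventually_elim simp
    then show False using F2(2) by (simp add: trivial_limit_def)
  qed
  then show thesis using that l lZ by blast
qed

text \<open>
  Krasnoselskii-Mann iteration of a map that is averaged for \<open>Q\<close>, with summable errors. The remainder
  \<open>R\<close> records any further decrease of the distance. Since the total decrease is finite, \<open>R (u n) l\<close> tends
  to zero; this is what later yields strong convergence.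
\<close>

theorem averaged_iteration_converges:
  assumes TV: "\<And>u. u \<in> V \<Longrightarrow> T u \<in> V"
    and avg: "\<And>u w. u \<in> V \<Longrightarrow> w \<in> V \<Longrightarrow>
      Q (T u - T w) (T u - T w) + \<kappa> * Q ((u - T u) - (w - T w)) ((u - T u) - (w - T w)) + R u w
        \<le> Q (u - w) (u - w)"
    and \<kappa>: "\<kappa> > 0" and R: "\<And>u w. 0 \<le> R u w"
    and uV: "\<And>n. u n \<in> V"
    and fp: "z0 \<in> V" "T z0 = z0"
    and step: "\<And>n. norm (u (Suc n) - (u n + lam n *\<^sub>R (T (u n) - u n))) \<le> e n" and e: "summable e"
    and eps: "\<epsilon> > 0" and lam: "\<And>n. \<epsilon> \<le> lam n \<and> lam n \<le> 1"
  obtains l where "l \<in> V" "T l = l" "\<And>w. w \<in> V \<Longrightarrow> (\<lambda>n. Q (u n) w) \<longlonglongrightarrow> Q l w"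
    "(\<lambda>n. R (u n) l) \<longlonglongrightarrow> 0" "bounded (range u)"
proof -
  define Z where "Z = {z \<in> V. T z = z}"
  define s where "s n = u n + lam n *\<^sub>R (T (u n) - u n)" for n
  define E where "E n = sqrt \<bar>M\<bar> * e n" for n
  have E0: "0 \<le> E n" for n
    unfolding E_def using order_trans[OF norm_ge_zero step] by (intro mult_nonneg_nonneg) auto
  have Esum: "summable E" unfolding E_def using e by (rule summable_mult)
  have Elim: "E \<longlonglongrightarrow> 0" using Esum by (rule summable_LIMSEQ_zero)
  have err: "nrm (u (Suc n) - s n) \<le> E n" for n
  proof -
    have "nrm (u (Suc n) - s n) \<le> sqrt \<bar>M\<bar> * norm (u (Suc n) - s n)" by (rule nrm_upper)
    also have "\<dots> \<le> E n" unfolding E_def s_def by (intro mult_left_mono step) auto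
    finally show ?thesis .
  qed
  \<comment> \<open>One exact relaxed step, before the error is added.\<close>
  have descent: "Q (s n - z) (s n - z)
      \<le> Q (u n - z) (u n - z) - \<epsilon> * (\<kappa> * Q (u n - T (u n)) (u n - T (u n)) + R (u n) z)"
    if z: "z \<in> Z" for n z
  proof -
    let ?g = "\<kappa> * Q (u n - T (u n)) (u n - T (u n)) + R (u n) z"
    have g: "0 \<le> ?g" using \<kappa> nonneg R by simp
    have l: "0 \<le> lam n" "lam n \<le> 1" "\<epsilon> \<le> lam n" using lam[of n] eps by auto
    have "s n - z = (1 - lam n) *\<^sub>R (u n - z) + lam n *\<^sub>R (T (u n) - z)"
      by (simp add: s_def algebra_simps)
    then have "Q (s n - z) (s n - z) \<le> (1 - lam n) * Q (u n - z) (u n - z) + lam n * Q (T (u n) - z) (T (u n) - z)"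
      using convex_bound l by metis
    also have "\<dots> \<le> (1 - lam n) * Q (u n - z) (u n - z) + lam n * (Q (u n - z) (u n - z) - ?g)"
      using avg[OF uV[of n], of z] z l by (intro add_left_mono mult_left_mono) (auto simp: Z_def)
    also have "\<dots> = Q (u n - z) (u n - z) - lam n * ?g" by (simp add: algebra_simps)
    also have "\<dots> \<le> Q (u n - z) (u n - z) - \<epsilon> * ?g"
      using mult_right_mono[OF l(3) g] by simp
    finally show ?thesis .
  qed
  have s_le: "nrm (s n - z) \<le> nrm (u n - z)" if "z \<in> Z" for n z
  proof -
    have "0 \<le> \<epsilon> * (\<kappa> * Q (u n - T (u n)) (u n - T (u n)) + R (u n) z)"
      using \<kappa> nonneg R eps by simp
    then show ?thesis unfolding nrm_def using descent[OF that, of n] by simp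
  qed
  have next_le: "nrm (u (Suc n) - z) \<le> nrm (s n - z) + E n" for n z
    using nrm_triangle[of "s n - z" "u (Suc n) - s n"] err[of n] by simp
  have conv: "convergent (\<lambda>n. nrm (u n - z))" if "z \<in> Z" for z
  proof (rule quasi_decreasing_convergent[OF nrm_nonneg _ E0 Esum])
    show "nrm (u (Suc n) - z) \<le> nrm (u n - z) + E n" for n
      using next_le[of n z] s_le[OF that, of n] by simp
  qed
  have convQ: "convergent (\<lambda>n. Q (u n - z) (u n - z))" if z: "z \<in> Z" for z
  proof -
    obtain c where "(\<lambda>n. nrm (u n - z)) \<longlonglongrightarrow> c" using conv[OF z] by (auto simp: convergent_def)
    then have "(\<lambda>n. (nrm (u n - z))\<^sup>2) \<longlonglongrightarrow> c\<^sup>2" by (rule tendsto_power)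
    then show ?thesis by (auto simp: nrm_sq convergent_def)
  qed
  have z0: "z0 \<in> Z" using fp by (simp add: Z_def)
  obtain K where K: "\<And>n. norm (u n) \<le> K"
  proof -
    obtain B where B: "\<And>n. nrm (u n - z0) \<le> B"
      using convergent_imp_Bseq[OF conv[OF z0]] by (auto simp: Bseq_def)
    have "norm (u n) \<le> B / sqrt m + norm z0" for n
    proof -
      have "norm (u n - z0) \<le> nrm (u n - z0) / sqrt m" by (rule norm_upper)
      also have "\<dots> \<le> B / sqrt m" using B m by (simp add: divide_right_mono)
      finally show ?thesis using norm_triangle_sub[of "u n" z0] by linarith
    qed
    then show thesis using that by blast
  qed
  have gap: "(\<lambda>n. \<kappa> * Q (u n - T (u n)) (u n - T (u n)) + R (u n) z) \<longlonglongrightarrow> 0" if z: "z \<in> Z" for z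
  proof -
    let ?g = "\<lambda>n. \<kappa> * Q (u n - T (u n)) (u n - T (u n)) + R (u n) z"
    let ?h = "\<lambda>n. ((nrm (u n - z))\<^sup>2 - (nrm (u (Suc n) - z))\<^sup>2 + 2 * nrm (u n - z) * E n + (E n)\<^sup>2) / \<epsilon>"
    obtain c where c: "(\<lambda>n. nrm (u n - z)) \<longlonglongrightarrow> c" using conv[OF z] by (auto simp: convergent_def)
    have "?h \<longlonglongrightarrow> (c\<^sup>2 - c\<^sup>2 + 2 * c * 0 + 0\<^sup>2) / \<epsilon>"
      by (intro tendsto_intros c Elim LIMSEQ_Suc[OF c]) (use eps in auto)
    then have h: "?h \<longlonglongrightarrow> 0" by simp
    have g0: "0 \<le> ?g n" for n using \<kappa> nonneg R by simp
    have "?g n \<le> ?h n" for n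
    proof -
      have "(nrm (u (Suc n) - z))\<^sup>2 \<le> (nrm (s n - z) + E n)\<^sup>2"
        by (intro power_mono next_le) simp
      also have "\<dots> = Q (s n - z) (s n - z) + 2 * nrm (s n - z) * E n + (E n)\<^sup>2"
        by (simp add: power2_sum nrm_sq)
      also have "\<dots> \<le> ((nrm (u n - z))\<^sup>2 - \<epsilon> * ?g n) + 2 * nrm (u n - z) * E n + (E n)\<^sup>2"
        using descent[OF z, of n] s_le[OF z, of n] E0[of n]
        by (intro add_mono mult_right_mono) (auto simp: nrm_sq)
      finally show ?thesis using eps by (simp add: pos_le_divide_eq mult.commute)
    qed
    with g0 show ?thesis by (intro real_tendsto_sandwich[OF _ _ tendsto_const h]) auto
  qed
  have res: "(\<lambda>n. nrm (u n - T (u n))) \<longlonglongrightarrow> 0"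
  proof -
    have "(\<lambda>n. Q (u n - T (u n)) (u n - T (u n))) \<longlonglongrightarrow> 0"
    proof (rule real_tendsto_sandwich[OF _ _ tendsto_const tendsto_divide_zero[OF gap[OF z0], of \<kappa>]])
      show "\<forall>\<^sub>F n in sequentially. Q (u n - T (u n)) (u n - T (u n))
          \<le> (\<kappa> * Q (u n - T (u n)) (u n - T (u n)) + R (u n) z0) / \<kappa>"
        using \<kappa> R by (auto simp: field_simps)
    qed (simp add: nonneg)
    from tendsto_real_sqrt[OF this] show ?thesis by (simp add: nrm_def)
  qed
  have Rlim: "(\<lambda>n. R (u n) z) \<longlonglongrightarrow> 0" if "z \<in> Z" for z
    by (rule real_tendsto_sandwich[OF _ _ tendsto_const gap[OF that]]) (use \<kappa> nonneg R in auto)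
  \<comment> \<open>If \<open>T l \<noteq> l\<close>, then \<open>u n\<close> would be asymptotically strictly closer to its weak limit \<open>l\<close> than to \<open>T l\<close>, while \<open>T\<close> is nonexpansive and \<open>T (u n) - u n\<close> tends to zero.\<close>
  have demiclosed: "l \<in> Z" if F: "F \<le> sequentially" "F \<noteq> bot" and l: "l \<in> V"
    and lim: "\<And>w. w \<in> V \<Longrightarrow> ((\<lambda>n. Q (u n) w) \<longlongrightarrow> Q l w) F" for F l
  proof -
    define d where "d = l - T l"
    define B where "B = sqrt \<bar>M\<bar> * (K + norm l)"
    have d: "d \<in> V" using l TV sub by (simp add: d_def subspace_diff)
    have B: "nrm (u n - l) \<le> B" for n
    proof -
      have "nrm (u n - l) \<le> sqrt \<bar>M\<bar> * norm (u n - l)" by (rule nrm_upper)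
      also have "\<dots> \<le> B" unfolding B_def
        using norm_triangle_ineq4[of "u n" l] K[of n] by (intro mult_left_mono) auto
      finally show ?thesis .
    qed
    have bound: "Q d d \<le> 2 * B * nrm (u n - T (u n)) + (nrm (u n - T (u n)))\<^sup>2 - 2 * (Q (u n) d - Q l d)" for n
    proof -
      have "0 \<le> \<kappa> * Q ((u n - T (u n)) - (l - T l)) ((u n - T (u n)) - (l - T l))"
        using \<kappa> nonneg by simp
      then have nonexp: "nrm (T (u n) - T l) \<le> nrm (u n - l)"
        unfolding nrm_def using avg[OF uV l, of n] R[of "u n" l] by simp
      have "nrm (u n - T l) \<le> nrm (u n - T (u n)) + nrm (T (u n) - T l)"
        using nrm_triangle[of "u n - T (u n)" "T (u n) - T l"] by simp
      then have "nrm (u n - T l) \<le> nrm (u n - T (u n)) + nrm (u n - l)" using nonexp by simp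
      then have "(nrm (u n - T l))\<^sup>2 \<le> (nrm (u n - T (u n)) + nrm (u n - l))\<^sup>2"
        by (intro power_mono) auto
      then have "(nrm (u n - T l))\<^sup>2 \<le> (nrm (u n - T (u n)))\<^sup>2 + (nrm (u n - l))\<^sup>2
          + 2 * nrm (u n - l) * nrm (u n - T (u n))"
        by (simp add: power2_sum mult.commute mult.left_commute)
      moreover have "2 * nrm (u n - l) * nrm (u n - T (u n)) \<le> 2 * B * nrm (u n - T (u n))"
        using B[of n] by (intro mult_right_mono) auto
      moreover have "(nrm (u n - T l))\<^sup>2 = (nrm (u n - l))\<^sup>2 + 2 * (Q (u n) d - Q l d) + Q d d"
      proof -
        have eq: "u n - T l = (u n - l) + d" by (simp add: d_def)
        show ?thesis unfolding eq by (simp add: nrm_sq Q_simps sym[of d "u n"] sym[of d l])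
      qed
      ultimately show ?thesis by linarith
    qed
    have resF: "((\<lambda>n. nrm (u n - T (u n))) \<longlongrightarrow> 0) F" using tendsto_mono[OF F(1) res] .
    have "((\<lambda>n. 2 * B * nrm (u n - T (u n)) + (nrm (u n - T (u n)))\<^sup>2 - 2 * (Q (u n) d - Q l d))
        \<longlongrightarrow> 2 * B * 0 + 0\<^sup>2 - 2 * (Q l d - Q l d)) F"
      by (intro tendsto_intros resF lim d)
    then have "Q d d \<le> 0"
      using tendsto_lowerbound[OF _ always_eventually F(2)] bound by fastforce
    then have "d = 0" using lower[of d] m order_trans by (fastforce simp: mult_le_0_iff)
    then show ?thesis using l by (simp add: Z_def d_def)
  qed
  obtain l where l: "l \<in> V" "l \<in> Z" "\<And>w. w \<in> V \<Longrightarrow> (\<lambda>n. Q (u n) w) \<longlonglongrightarrow> Q l w"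
  proof (rule weakly_convergent_of_bounded[of u K Z])
    show "l \<in> Z" if "F \<le> sequentially" "F \<noteq> bot" "l \<in> V"
      "\<And>w. w \<in> V \<Longrightarrow> ((\<lambda>n. Q (u n) w) \<longlongrightarrow> Q l w) F" for F l
      using demiclosed that by blast
  qed (use K convQ in blast)+
  have "bounded (range u)" using K by (auto simp: bounded_iff)
  then show thesis using that[of l] l Rlim[OF l(2)] by (simp add: Z_def)
qed

end

section \<open>Maximally monotone operators and their resolvents\<close>

lemma maximally_monotone_on_iff:
  "maximally_monotone_on V T \<longleftrightarrow>
     (\<forall>x u. u \<in> T x \<longrightarrow> x \<in> V \<and> u \<in> V) \<and>
     (\<forall>x u y v. u \<in> T x \<longrightarrow> v \<in> T y \<longrightarrow> 0 \<le> (x - y) \<bullet> (u - v)) \<and>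
     (\<forall>x\<in>V. \<forall>u\<in>V. (\<forall>y v. v \<in> T y \<longrightarrow> 0 \<le> (x - y) \<bullet> (u - v)) \<longrightarrow> u \<in> T x)"
  (is "?L \<longleftrightarrow> ?V \<and> ?M \<and> ?X")
proof
  assume L: ?L
  then have V: ?V and M: ?M
    by (auto simp: maximally_monotone_on_def monotone_op_def gra_def)
  moreover have ?X
  proof (intro ballI impI, rule ccontr)
    fix x u assume xu: "x \<in> V" "u \<in> V" "\<forall>y v. v \<in> T y \<longrightarrow> 0 \<le> (x - y) \<bullet> (u - v)" "u \<notin> T x"
    define S where "S y = T y \<union> {w. y = x \<and> w = u}" for y
    have swap: "(y - x) \<bullet> (v - u) = (x - y) \<bullet> (u - v)" for y v
      by (simp add: inner_diff_left inner_diff_right)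
    have "gra S \<subseteq> V \<times> V" using V xu by (auto simp: gra_def S_def)
    moreover have "monotone_op S" using M xu(3)
      by (auto simp: monotone_op_def gra_def S_def swap)
    moreover have "gra T \<subset> gra S" using xu(4) by (auto simp: gra_def S_def)
    ultimately show False using L unfolding maximally_monotone_on_def by blast
  qed
  ultimately show "?V \<and> ?M \<and> ?X" by blast
next
  assume R: "?V \<and> ?M \<and> ?X"
  show ?L unfolding maximally_monotone_on_def
  proof (intro conjI notI)
    show "gra T \<subseteq> V \<times> V" using R unfolding gra_def by blast
    show "monotone_op T" using R unfolding gra_def monotone_op_def by blast
    assume "\<exists>S. gra S \<subseteq> V \<times> V \<and> monotone_op S \<and> gra T \<subset> gra S"
    then obtain S where S: "gra S \<subseteq> V \<times> V" "monotone_op S" "gra T \<subset> gra S" by blast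
    then obtain x u where xu: "u \<in> S x" "u \<notin> T x" unfolding gra_def by blast
    have "0 \<le> (x - y) \<bullet> (u - v)" if "v \<in> T y" for y v
      using S(2,3) that xu(1) unfolding monotone_op_def gra_def by blast
    moreover have "x \<in> V" "u \<in> V" using S(1) xu by (auto simp: gra_def)
    ultimately show False using R xu(2) by blast
  qed
qed

lemma maximally_monotone_inv:
  assumes "maximally_monotone_on V T"
  shows "maximally_monotone_on V (inv_op T)"
  unfolding maximally_monotone_on_iff inv_op_def mem_Collect_eq
proof (intro conjI allI impI ballI)
  fix u x v y assume "u \<in> T x" "v \<in> T y"
  then have "0 \<le> (x - y) \<bullet> (u - v)" using assms unfolding maximally_monotone_on_iff by blast
  then show "0 \<le> (u - v) \<bullet> (x - y)" by (simp only: inner_commute[of "u - v"])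
next
  fix u x assume ux: "u \<in> V" "x \<in> V" "\<forall>v y. v \<in> T y \<longrightarrow> 0 \<le> (u - v) \<bullet> (x - y)"
  then have "\<forall>y v. v \<in> T y \<longrightarrow> 0 \<le> (x - y) \<bullet> (u - v)" by (simp only: inner_commute[of "u - _"]) blast
  then show "u \<in> T x" using ux assms unfolding maximally_monotone_on_iff by blast
qed (use assms in \<open>unfold maximally_monotone_on_iff, blast\<close>)+

lemma mem_scale_op: "c > 0 \<Longrightarrow> u \<in> scale_op c T x \<longleftrightarrow> (1/c) *\<^sub>R u \<in> T x"
proof
  assume "c > 0" "(1/c) *\<^sub>R u \<in> T x"
  then show "u \<in> scale_op c T x" unfolding scale_op_def by (intro image_eqI[of _ _ "(1/c) *\<^sub>R u"]) simp_all
qed (auto simp: scale_op_def)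

lemma maximally_monotone_scale:
  assumes V: "subspace V" and T: "maximally_monotone_on V T" and c: "c > 0"
  shows "maximally_monotone_on V (scale_op c T)"
  unfolding maximally_monotone_on_iff mem_scale_op[OF c]
proof (intro conjI allI impI ballI)
  fix x u assume "(1/c) *\<^sub>R u \<in> T x"
  then have "x \<in> V" "(1/c) *\<^sub>R u \<in> V" using T unfolding maximally_monotone_on_iff by blast+
  moreover have "u = c *\<^sub>R ((1/c) *\<^sub>R u)" using c by simp
  ultimately show "x \<in> V" "u \<in> V" using V subspace_scale by metis+
next
  fix x u y v assume "(1/c) *\<^sub>R u \<in> T x" "(1/c) *\<^sub>R v \<in> T y"
  then have "0 \<le> (x - y) \<bullet> ((1/c) *\<^sub>R u - (1/c) *\<^sub>R v)"
    using T unfolding maximally_monotone_on_iff by blast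
  then show "0 \<le> (x - y) \<bullet> (u - v)"
    using c by (simp add: zero_le_divide_iff flip: scaleR_diff_right)
next
  fix x u assume xu: "x \<in> V" "u \<in> V" "\<forall>y v. (1/c) *\<^sub>R v \<in> T y \<longrightarrow> 0 \<le> (x - y) \<bullet> (u - v)"
  have "0 \<le> (x - y) \<bullet> ((1/c) *\<^sub>R u - v)" if "v \<in> T y" for y v
  proof -
    have "0 \<le> (x - y) \<bullet> (u - c *\<^sub>R v)" using xu(3) that c by simp
    also have "u - c *\<^sub>R v = c *\<^sub>R ((1/c) *\<^sub>R u - v)" using c by (simp add: scaleR_diff_right)
    finally show ?thesis using c by (simp add: zero_le_mult_iff)
  qed
  then show "(1/c) *\<^sub>R u \<in> T x"
    using T xu V subspace_scale unfolding maximally_monotone_on_iff by blast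
qed

text \<open>
  Minty's theorem. The goal is a point \<open>x\<close> with \<open>0 \<le> \<langle>x - y, (w - x) - v\<rangle>\<close> for all \<open>(y, v)\<close> in the graph;
  maximality then puts \<open>(x, w - x)\<close> into the graph. These inequalities are the optimality conditions of a
  convex minimization: over the convex hull of the triples \<open>(y, v - w, \<langle>y, v - w\<rangle>)\<close>, minimize
  \<open>q (a, b, s) = \<parallel>(a - b) / 2\<parallel>\<^sup>2 + s\<close>. Monotonicity extends to the hull as \<open>\<langle>a, b\<rangle> \<le> s\<close>, so
  \<open>q \<ge> \<parallel>(a + b) / 2\<parallel>\<^sup>2 \<ge> 0\<close>. Along a minimizing sequence \<open>(a - b) / 2\<close> converges, and its limit is \<open>x\<close>.
\<close>

lemma Minty:
  fixes V :: "'a::{real_inner,complete_space} set"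
  assumes V: "hilbert_subspace V" and T: "maximally_monotone_on V T" and w: "w \<in> V"
  obtains x where "w - x \<in> T x"
proof -
  have sub: "subspace V" and cl: "closed V" using V by (auto simp: hilbert_subspace_def)
  have TV: "\<And>x u. u \<in> T x \<Longrightarrow> x \<in> V \<and> u \<in> V"
    and mono: "\<And>x u y v. u \<in> T x \<Longrightarrow> v \<in> T y \<Longrightarrow> 0 \<le> (x - y) \<bullet> (u - v)"
    and maxi: "\<And>x u. x \<in> V \<Longrightarrow> u \<in> V \<Longrightarrow> (\<And>y v. v \<in> T y \<Longrightarrow> 0 \<le> (x - y) \<bullet> (u - v)) \<Longrightarrow> u \<in> T x"
    using T unfolding maximally_monotone_on_iff by blast+
  define Gr where "Gr = {(y, v - w, y \<bullet> (v - w)) | y v. v \<in> T y}"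
  define S where "S = convex hull Gr"
  have conv: "convex S" by (simp add: S_def convex_convex_hull)
  define \<pi> :: "'a \<times> 'a \<times> real \<Rightarrow> 'a" where "\<pi> = (\<lambda>(a, b, s). (1/2) *\<^sub>R (a - b))"
  define q :: "'a \<times> 'a \<times> real \<Rightarrow> real" where "q p = (norm (\<pi> p))\<^sup>2 + snd (snd p)" for p
  have halfspace: "convex {(a, b, s). 0 \<le> s - a \<bullet> b' - a' \<bullet> b + t}" for a' b' :: 'a and t :: real
  proof (rule convexI, clarsimp)
    fix a b a2 b2 :: 'a and s s2 u v :: real
    assume "0 \<le> s - a \<bullet> b' - a' \<bullet> b + t" "0 \<le> s2 - a2 \<bullet> b' - a' \<bullet> b2 + t" "0 \<le> u" "0 \<le> v"
      and uv: "u + v = 1"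
    then have "0 \<le> u * (s - a \<bullet> b' - a' \<bullet> b + t) + v * (s2 - a2 \<bullet> b' - a' \<bullet> b2 + t)" by simp
    also have "\<dots> = u * s + v * s2 - (u *\<^sub>R a + v *\<^sub>R a2) \<bullet> b' - a' \<bullet> (u *\<^sub>R b + v *\<^sub>R b2) + (u + v) * t"
      by (simp add: inner_add_left inner_add_right algebra_simps)
    finally show "0 \<le> u * s + v * s2 - (u *\<^sub>R a + v *\<^sub>R a2) \<bullet> b' - a' \<bullet> (u *\<^sub>R b + v *\<^sub>R b2) + t"
      by (simp add: uv)
  qed
  \<comment> \<open>Monotonicity is affine in each of its two graph points separately, so it passes to the convex hull one point at a time.\<close>
  have 1: "0 \<le> s - a \<bullet> b' - a' \<bullet> b + t" if p: "(a, b, s) \<in> S" and p': "(a', b', t) \<in> Gr" for a b s a' b' t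
  proof -
    have "Gr \<subseteq> {(a, b, s). 0 \<le> s - a \<bullet> b' - a' \<bullet> b + t}"
    proof clarify
      fix a b s assume "(a, b, s) \<in> Gr"
      then obtain v v' where v: "v \<in> T a" "b = v - w" "s = a \<bullet> b" "v' \<in> T a'" "b' = v' - w" "t = a' \<bullet> b'"
        using p' by (auto simp: Gr_def)
      have "0 \<le> (a - a') \<bullet> (v - v')" using mono v by blast
      also have "v - v' = b - b'" using v by simp
      finally show "0 \<le> s - a \<bullet> b' - a' \<bullet> b + t" using v
        by (simp add: inner_diff_left inner_diff_right)
    qed
    then have "S \<subseteq> {(a, b, s). 0 \<le> s - a \<bullet> b' - a' \<bullet> b + t}"
      unfolding S_def by (rule hull_minimal) (rule halfspace)
    then show ?thesis using p by blast
  qed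
  have 2: "0 \<le> s - a \<bullet> b' - a' \<bullet> b + t" if "(a, b, s) \<in> S" "(a', b', t) \<in> S" for a b s a' b' t
  proof -
    have "Gr \<subseteq> {(a', b', t). 0 \<le> t - a' \<bullet> b - a \<bullet> b' + s}" using 1[OF that(1)] by force
    then have "S \<subseteq> {(a', b', t). 0 \<le> t - a' \<bullet> b - a \<bullet> b' + s}"
      unfolding S_def by (rule hull_minimal) (rule halfspace)
    then show ?thesis using that(2) by auto
  qed
  have q0: "0 \<le> q p" if "p \<in> S" for p
  proof -
    obtain a b s where p: "p = (a, b, s)" by (cases p)
    have "a \<bullet> b \<le> s" using 2[of a b s a b s] that p by simp
    moreover have "(norm ((1/2) *\<^sub>R (a - b)))\<^sup>2 + a \<bullet> b = (norm ((1/2) *\<^sub>R (a + b)))\<^sup>2"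
      unfolding power2_norm_eq_inner
      by (simp add: inner_diff_left inner_diff_right inner_add_left inner_add_right
          inner_commute[of b a] field_simps)
    moreover have "q p = (norm ((1/2) *\<^sub>R (a - b)))\<^sup>2 + s" by (simp add: q_def \<pi>_def p)
    ultimately show ?thesis by (smt (verit) zero_le_power2)
  qed
  have \<pi>_lin: "\<pi> (u *\<^sub>R p + v *\<^sub>R p') = u *\<^sub>R \<pi> p + v *\<^sub>R \<pi> p'" for u v p p'
    by (cases p; cases p') (simp add: \<pi>_def algebra_simps)
  have mid: "\<exists>c\<in>S. q c + (1/4) * (norm (\<pi> p - \<pi> p'))\<^sup>2 \<le> (q p + q p') / 2" if "p \<in> S" "p' \<in> S" for p p'
  proof (rule bexI)
    show "(1/2) *\<^sub>R p + (1/2) *\<^sub>R p' \<in> S" using convexD[OF conv that] by simp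
    show "q ((1/2) *\<^sub>R p + (1/2) *\<^sub>R p') + (1/4) * (norm (\<pi> p - \<pi> p'))\<^sup>2 \<le> (q p + q p') / 2"
      unfolding q_def \<pi>_lin power2_norm_eq_inner
      by (simp add: inner_diff_left inner_diff_right inner_add_left inner_add_right
          inner_commute[of "\<pi> p'" "\<pi> p"] field_simps)
  qed
  have "Gr \<noteq> {}"
  proof
    assume "Gr = {}"
    then have "v \<notin> T y" for v y by (auto simp: Gr_def)
    then show False using maxi[of 0 0] subspace_0[OF sub] by blast
  qed
  then have "S \<noteq> {}" by (simp add: S_def)
  then obtain p x I where p: "\<And>n::nat. p n \<in> S" and I: "\<And>s. s \<in> S \<Longrightarrow> I \<le> q s"
    and lim: "(\<lambda>n. q (p n)) \<longlonglongrightarrow> I" "(\<lambda>n. \<pi> (p n)) \<longlonglongrightarrow> x"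
    using minimizing_sequence[of S 0 q "1/4" \<pi>] q0 mid by (metis zero_less_divide_1_iff zero_less_numeral)
  have I0: "0 \<le> I" using LIMSEQ_le_const[OF lim(1)] q0 p by blast
  have "x \<in> V"
  proof -
    have "Gr \<subseteq> V \<times> V \<times> UNIV" using TV w sub by (auto simp: Gr_def subspace_diff)
    moreover have "convex (V \<times> V \<times> (UNIV :: real set))"
      using sub by (intro convex_Times) (auto simp: subspace_imp_convex)
    ultimately have "S \<subseteq> V \<times> V \<times> UNIV" unfolding S_def by (rule hull_minimal)
    then have "\<pi> (p n) \<in> V" for n
      using p[of n] sub by (auto simp: \<pi>_def subspace_diff subspace_scale split: prod.split)
    then show ?thesis using closed_sequentially[OF cl _ lim(2)] by blast
  qed
  moreover have "0 \<le> (x - y) \<bullet> ((w - x) - v)" if v: "v \<in> T y" for y v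
  proof -
    define e where "e = (y, v - w, y \<bullet> (v - w))"
    have e: "e \<in> S" unfolding S_def e_def using v by (intro hull_inc) (auto simp: Gr_def)
    define X where "X = 2 * (x \<bullet> (\<pi> e - x)) + snd (snd e) - (I - (norm x)\<^sup>2)"
    \<comment> \<open>First-order optimality: compare the minimizing sequence with the segments from it towards the graph point.\<close>
    have seg: "0 \<le> t * X + t\<^sup>2 * (norm (\<pi> e - x))\<^sup>2" if t: "0 \<le> t" "t \<le> 1" for t
    proof -
      let ?f = "\<lambda>n. q (p n) + (t * (2 * (\<pi> (p n) \<bullet> (\<pi> e - \<pi> (p n))) + snd (snd e)
              - (q (p n) - (norm (\<pi> (p n)))\<^sup>2)) + t\<^sup>2 * (norm (\<pi> e - \<pi> (p n)))\<^sup>2)"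
      have "I \<le> ?f n" for n
      proof -
        have "(1 - t) *\<^sub>R p n + t *\<^sub>R e \<in> S" using convexD[OF conv p e] t by simp
        then have "I \<le> q ((1 - t) *\<^sub>R p n + t *\<^sub>R e)" by (rule I)
        also have "\<dots> = ?f n"
          unfolding q_def \<pi>_lin power2_norm_eq_inner
          by (simp add: inner_diff_left inner_diff_right inner_add_left inner_add_right
              inner_commute[of "\<pi> e" "\<pi> (p n)"] algebra_simps power2_eq_square)
        finally show ?thesis .
      qed
      moreover have "?f \<longlonglongrightarrow> I + (t * X + t\<^sup>2 * (norm (\<pi> e - x))\<^sup>2)"
        unfolding X_def by (intro tendsto_intros lim)
      ultimately have "I \<le> I + (t * X + t\<^sup>2 * (norm (\<pi> e - x))\<^sup>2)" by (meson LIMSEQ_le_const)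
      then show ?thesis by simp
    qed
    have "0 \<le> X"
    proof (rule tendsto_lowerbound)
      show "((\<lambda>t. X + t * (norm (\<pi> e - x))\<^sup>2) \<longlongrightarrow> X) (at_right 0)"
        by (auto intro!: tendsto_eq_intros)
      show "\<forall>\<^sub>F t in at_right 0. 0 \<le> X + t * (norm (\<pi> e - x))\<^sup>2"
        using eventually_at_right_real[OF zero_less_one]
      proof eventually_elim
        case (elim t)
        then have "0 \<le> t * (X + t * (norm (\<pi> e - x))\<^sup>2)"
          using seg[of t] by (simp add: algebra_simps power2_eq_square)
        then show ?case using elim by (simp add: zero_le_mult_iff)
      qed
    qed simp
    then show ?thesis using I0
      by (simp add: X_def e_def \<pi>_def power2_norm_eq_inner inner_diff_left inner_diff_right
          inner_commute algebra_simps)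
  qed
  ultimately have "w - x \<in> T x" using maxi w sub by (simp add: subspace_diff)
  then show thesis by (rule that)
qed

text \<open>
  Existence of the resolvent is Minty's theorem; uniqueness comes from monotonicity.
\<close>

lemma resolvent_eq_iff:
  fixes V :: "'a::{real_inner,complete_space} set"
  assumes V: "hilbert_subspace V" and T: "maximally_monotone_on V T" and \<gamma>: "\<gamma> > 0" and w: "w \<in> V"
  shows "resolvent (scale_op \<gamma> T) w = p \<longleftrightarrow> (1/\<gamma>) *\<^sub>R (w - p) \<in> T p"
proof -
  have sub: "subspace V" using V by (simp add: hilbert_subspace_def)
  define P where "P = {x. (1/\<gamma>) *\<^sub>R (w - x) \<in> T x}"
  have inv: "inv_op (\<lambda>x. {x} + scale_op \<gamma> T x) w = P"
  proof -
    have "w \<in> {x} + scale_op \<gamma> T x \<longleftrightarrow> w - x \<in> scale_op \<gamma> T x" for x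
    proof
      assume "w - x \<in> scale_op \<gamma> T x"
      then have "x + (w - x) \<in> {x} + scale_op \<gamma> T x" by (intro set_plus_intro) auto
      then show "w \<in> {x} + scale_op \<gamma> T x" by simp
    qed (auto simp: set_plus_def)
    then show ?thesis by (simp add: inv_op_def P_def mem_scale_op[OF \<gamma>])
  qed
  obtain x where "w - x \<in> scale_op \<gamma> T x"
    using Minty[OF V maximally_monotone_scale[OF sub T \<gamma>] w] .
  then have x: "x \<in> P" by (simp add: P_def mem_scale_op[OF \<gamma>])
  have uniq: "x' = x" if "x' \<in> P" for x'
  proof -
    have "0 \<le> (x' - x) \<bullet> ((1/\<gamma>) *\<^sub>R (w - x') - (1/\<gamma>) *\<^sub>R (w - x))"
      using T that x unfolding P_def maximally_monotone_on_iff by blast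
    also have "(1/\<gamma>) *\<^sub>R (w - x') - (1/\<gamma>) *\<^sub>R (w - x) = - ((1/\<gamma>) *\<^sub>R (x' - x))"
      by (simp only: scaleR_diff_right) simp
    also have "(x' - x) \<bullet> \<dots> = - (norm (x' - x))\<^sup>2 / \<gamma>"
      by (simp only: inner_minus_right inner_scaleR_right power2_norm_eq_inner) simp
    finally show ?thesis using \<gamma> by (simp add: divide_le_0_iff)
  qed
  have P: "P = {x}" using x uniq by blast
  then have "resolvent (scale_op \<gamma> T) w = x" by (simp add: resolvent_def as_map_def inv)
  moreover have "(1/\<gamma>) *\<^sub>R (w - p) \<in> T p \<longleftrightarrow> p = x" using P by (auto simp: P_def)
  ultimately show ?thesis by auto
qed

lemma resolvent_mem:
  assumes "hilbert_subspace V" "maximally_monotone_on V T" "\<gamma> > 0" "w \<in> V"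
  shows "(1/\<gamma>) *\<^sub>R (w - resolvent (scale_op \<gamma> T) w) \<in> T (resolvent (scale_op \<gamma> T) w)"
    and "resolvent (scale_op \<gamma> T) w \<in> V"
proof -
  show *: "(1/\<gamma>) *\<^sub>R (w - resolvent (scale_op \<gamma> T) w) \<in> T (resolvent (scale_op \<gamma> T) w)"
    using resolvent_eq_iff[OF assms] by blast
  then show "resolvent (scale_op \<gamma> T) w \<in> V"
    using assms(2) unfolding maximally_monotone_on_iff by blast
qed

lemma resolvent_nonexpansive:
  assumes V: "hilbert_subspace V" and T: "maximally_monotone_on V T" and \<gamma>: "\<gamma> > 0"
    and w: "w \<in> V" "w' \<in> V"
  shows "norm (resolvent (scale_op \<gamma> T) w - resolvent (scale_op \<gamma> T) w') \<le> norm (w - w')"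
proof -
  let ?p = "resolvent (scale_op \<gamma> T) w" and ?p' = "resolvent (scale_op \<gamma> T) w'"
  have "0 \<le> (?p - ?p') \<bullet> ((1/\<gamma>) *\<^sub>R (w - ?p) - (1/\<gamma>) *\<^sub>R (w' - ?p'))"
    using T resolvent_mem(1)[OF V T \<gamma> w(1)] resolvent_mem(1)[OF V T \<gamma> w(2)]
    unfolding maximally_monotone_on_iff by blast
  also have "(1/\<gamma>) *\<^sub>R (w - ?p) - (1/\<gamma>) *\<^sub>R (w' - ?p') = (1/\<gamma>) *\<^sub>R ((w - w') - (?p - ?p'))"
    by (simp only: scaleR_diff_right) simp
  finally have "0 \<le> (1/\<gamma>) * ((?p - ?p') \<bullet> ((w - w') - (?p - ?p')))"
    by (simp only: inner_scaleR_right)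
  then have "0 \<le> (?p - ?p') \<bullet> ((w - w') - (?p - ?p'))"
    using \<gamma> by (simp only: zero_le_mult_iff) auto
  then have "(norm (?p - ?p'))\<^sup>2 \<le> (?p - ?p') \<bullet> (w - w')"
    by (simp add: power2_norm_eq_inner inner_diff_right)
  also have "\<dots> \<le> norm (?p - ?p') * norm (w - w')" by (rule norm_cauchy_schwarz)
  finally show ?thesis by (cases "?p = ?p'") (simp_all add: power2_eq_square)
qed

text \<open>
  Surjectivity of \<open>D\<close> is Minty's theorem for \<open>(D - \<nu> Id) / \<nu>\<close>. That operator is monotone by strong
  monotonicity, and maximal because a monotone extension of it yields one of \<open>D\<close> by scaling with \<open>\<nu>\<close>
  and adding \<open>\<nu> Id\<close> back.
\<close>

lemma strongly_monotone_inverse: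
  fixes V :: "'a::{real_inner,complete_space} set"
  assumes V: "hilbert_subspace V" and D: "maximally_monotone_on V D" and sm: "strongly_monotone \<nu> D"
  shows inverse_strongly_monotone_singleton: "v \<in> V \<Longrightarrow> inv_op D v = {as_map (inv_op D) v}"
    and inverse_strongly_monotone_mem: "v \<in> V \<Longrightarrow> as_map (inv_op D) v \<in> V"
    and inverse_strongly_monotone_cocoercive: "v \<in> V \<Longrightarrow> v' \<in> V \<Longrightarrow>
      \<nu> * (norm (as_map (inv_op D) v - as_map (inv_op D) v'))\<^sup>2
        \<le> (as_map (inv_op D) v - as_map (inv_op D) v') \<bullet> (v - v')"
proof -
  have sub: "subspace V" using V by (simp add: hilbert_subspace_def)
  have \<nu>: "\<nu> > 0" using sm by (simp add: strongly_monotone_def)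
  have DV: "\<And>x u. u \<in> D x \<Longrightarrow> x \<in> V \<and> u \<in> V"
    and maxi: "\<And>x u. x \<in> V \<Longrightarrow> u \<in> V \<Longrightarrow> (\<And>y v. v \<in> D y \<Longrightarrow> 0 \<le> (x - y) \<bullet> (u - v)) \<Longrightarrow> u \<in> D x"
    using D unfolding maximally_monotone_on_iff by blast+
  have strong: "\<nu> * (norm (x - y))\<^sup>2 \<le> (x - y) \<bullet> (u - v)" if "u \<in> D x" "v \<in> D y" for x y u v
  proof -
    have "0 \<le> (x - y) \<bullet> ((u - \<nu> *\<^sub>R x) - (v - \<nu> *\<^sub>R y))"
      using sm that unfolding strongly_monotone_def monotone_op_def gra_def by blast
    also have "(u - \<nu> *\<^sub>R x) - (v - \<nu> *\<^sub>R y) = (u - v) - \<nu> *\<^sub>R (x - y)" by (simp add: algebra_simps)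
    finally show ?thesis
      by (simp only: inner_diff_right[of _ "u - v"] inner_scaleR_right power2_norm_eq_inner diff_ge_0_iff_ge)
  qed
  define T where "T x = {w. \<nu> *\<^sub>R (w + x) \<in> D x}" for x
  have maxT: "maximally_monotone_on V T"
    unfolding maximally_monotone_on_iff T_def mem_Collect_eq
  proof (intro conjI allI impI ballI)
    fix x w assume a: "\<nu> *\<^sub>R (w + x) \<in> D x"
    then show x: "x \<in> V" using DV by blast
    have "w = (1/\<nu>) *\<^sub>R (\<nu> *\<^sub>R (w + x)) - x" using \<nu> by simp
    then show "w \<in> V" using DV[OF a] x sub by (metis subspace_scale subspace_diff)
  next
    fix x u y v assume "\<nu> *\<^sub>R (u + x) \<in> D x" "\<nu> *\<^sub>R (v + y) \<in> D y"
    from strong[OF this] have "\<nu> * (norm (x - y))\<^sup>2 \<le> (x - y) \<bullet> (\<nu> *\<^sub>R (u + x) - \<nu> *\<^sub>R (v + y))" .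
    also have "\<nu> *\<^sub>R (u + x) - \<nu> *\<^sub>R (v + y) = \<nu> *\<^sub>R ((u - v) + (x - y))"
      by (simp add: algebra_simps)
    also have "(x - y) \<bullet> \<dots> = \<nu> * ((x - y) \<bullet> (u - v) + (norm (x - y))\<^sup>2)"
      by (simp only: inner_scaleR_right inner_add_right power2_norm_eq_inner)
    finally show "0 \<le> (x - y) \<bullet> (u - v)" using \<nu> by simp
  next
    fix x u assume xu: "x \<in> V" "u \<in> V" "\<forall>y v. \<nu> *\<^sub>R (v + y) \<in> D y \<longrightarrow> 0 \<le> (x - y) \<bullet> (u - v)"
    show "\<nu> *\<^sub>R (u + x) \<in> D x"
    proof (rule maxi)
      fix y v assume v: "v \<in> D y"
      have "\<nu> *\<^sub>R (((1/\<nu>) *\<^sub>R v - y) + y) \<in> D y" using v \<nu> by simp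
      then have "0 \<le> (x - y) \<bullet> (u - ((1/\<nu>) *\<^sub>R v - y))" using xu(3) by blast
      then have "0 \<le> \<nu> * ((x - y) \<bullet> (u - ((1/\<nu>) *\<^sub>R v - y)) + (x - y) \<bullet> (x - y))"
        using \<nu> by (intro mult_nonneg_nonneg add_nonneg_nonneg) auto
      also have "\<dots> = (x - y) \<bullet> (\<nu> *\<^sub>R ((u - ((1/\<nu>) *\<^sub>R v - y)) + (x - y)))"
        by (simp only: inner_scaleR_right inner_add_right)
      also have "\<nu> *\<^sub>R ((u - ((1/\<nu>) *\<^sub>R v - y)) + (x - y)) = \<nu> *\<^sub>R (u + x) - v"
        using \<nu> by (simp add: algebra_simps)
      finally show "0 \<le> (x - y) \<bullet> (\<nu> *\<^sub>R (u + x) - v)" .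
    qed (use xu sub in \<open>simp_all add: subspace_add subspace_scale\<close>)
  qed
  have ex: "\<exists>x. v \<in> D x" if v: "v \<in> V" for v
  proof -
    obtain x where "(1/\<nu>) *\<^sub>R v - x \<in> T x"
      using Minty[OF V maxT] v sub subspace_scale by blast
    then show ?thesis using \<nu> by (auto simp: T_def)
  qed
  have uniq: "x = y" if "v \<in> D x" "v \<in> D y" for x y v
    using strong[OF that] \<nu> by (simp add: mult_le_0_iff)
  have single: "inv_op D v = {as_map (inv_op D) v}" if v: "v \<in> V" for v
  proof -
    obtain x where "v \<in> D x" using ex[OF v] by blast
    then have "inv_op D v = {x}" using uniq by (auto simp: inv_op_def)
    then show ?thesis by (simp add: as_map_def)
  qed
  have mem: "v \<in> D (as_map (inv_op D) v)" if "v \<in> V" for v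
    using single[OF that] by (auto simp: inv_op_def)
  show "v \<in> V \<Longrightarrow> inv_op D v = {as_map (inv_op D) v}" by (rule single)
  show "v \<in> V \<Longrightarrow> as_map (inv_op D) v \<in> V" using mem DV by blast
  show "v \<in> V \<Longrightarrow> v' \<in> V \<Longrightarrow> \<nu> * (norm (as_map (inv_op D) v - as_map (inv_op D) v'))\<^sup>2
        \<le> (as_map (inv_op D) v - as_map (inv_op D) v') \<bullet> (v - v')"
    using strong mem by blast
qed

section \<open>Adjoints and uniform monotonicity\<close>

text \<open>
  The adjoint is defined by a choice, so its characteristic equation rests on existence, which the Riesz
  representation supplies.
\<close>

lemma adjoint_eq:
  fixes f :: "'a::{real_inner,complete_space} \<Rightarrow> 'b::real_inner"
  assumes f: "bounded_linear f"
  shows "f x \<bullet> y = x \<bullet> adjoint f y"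
proof -
  interpret f: bounded_linear f by fact
  interpret hilbert_form UNIV "inner :: 'a \<Rightarrow> 'a \<Rightarrow> real" 1 1
  proof
    show "a \<bullet> b = b \<bullet> a" for a b :: 'a by (rule inner_commute)
  qed (simp_all add: inner_add_left power2_norm_eq_inner)
  have "\<exists>w. \<forall>x. f x \<bullet> y = x \<bullet> w" for y
  proof -
    obtain K where K: "\<And>x. norm (f x) \<le> norm x * K" using f.bounded by blast
    have "\<bar>f x \<bullet> y\<bar> \<le> (K * norm y) * norm x" for x
    proof -
      have "\<bar>f x \<bullet> y\<bar> \<le> norm (f x) * norm y" by (rule Cauchy_Schwarz_ineq2)
      also have "\<dots> \<le> (norm x * K) * norm y" using K by (intro mult_right_mono) auto
      finally show ?thesis by (simp add: mult.commute mult.left_commute)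
    qed
    then obtain w where "\<And>x. w \<bullet> x = f x \<bullet> y"
      using representation[of "\<lambda>x. f x \<bullet> y" "K * norm y"]
      by (auto simp: f.add f.scaleR inner_add_left)
    then show ?thesis by (metis inner_commute)
  qed
  then have "\<exists>f'. \<forall>x y. f x \<bullet> y = x \<bullet> f' y" by metis
  then have "\<forall>x y. f x \<bullet> y = x \<bullet> adjoint f y" unfolding adjoint_def by (rule someI_ex)
  then show ?thesis by blast
qed

text \<open>
  The modulus at \<open>\<parallel>x - y\<^sub>n\<parallel>\<close> is dominated by the pairing. As it is increasing and positive at every
  \<open>e > 0\<close>, the distance must eventually drop below \<open>e\<close>.
\<close>

lemma uniformly_monotone_at_tendsto:
  assumes T: "uniformly_monotone_at T x" and u: "u \<in> T x" and v: "\<And>n. v n \<in> T (y n)"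
    and lim: "(\<lambda>n. (x - y n) \<bullet> (u - v n)) \<longlonglongrightarrow> 0"
  shows "y \<longlonglongrightarrow> x"
proof -
  obtain \<phi> :: "real \<Rightarrow> ereal" where \<phi>: "\<And>t. t \<ge> 0 \<Longrightarrow> \<phi> t \<ge> 0" "mono_on {0..} \<phi>"
      "\<And>t. t \<ge> 0 \<Longrightarrow> \<phi> t = 0 \<longleftrightarrow> t = 0"
      and bd: "\<And>n. \<phi> (norm (x - y n)) \<le> ereal ((x - y n) \<bullet> (u - v n))"
    using T u v unfolding uniformly_monotone_at_def gra_def by fastforce
  show ?thesis
  proof (rule tendstoI)
    fix e :: real assume e: "e > 0"
    then have "0 < \<phi> e" using \<phi>(1)[of e] \<phi>(3)[of e] by (simp add: less_le)
    moreover have "(\<lambda>n. ereal ((x - y n) \<bullet> (u - v n))) \<longlonglongrightarrow> 0"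
      using lim by (simp add: zero_ereal_def)
    ultimately have "\<forall>\<^sub>F n in sequentially. ereal ((x - y n) \<bullet> (u - v n)) < \<phi> e"
      by (rule order_tendstoD(2)[rotated])
    then show "\<forall>\<^sub>F n in sequentially. dist (y n) x < e"
    proof eventually_elim
      case (elim n)
      then have "\<phi> (norm (x - y n)) < \<phi> e" using bd le_less_trans by blast
      then have "\<not> e \<le> norm (x - y n)" using mono_onD[OF \<phi>(2), of e "norm (x - y n)"] e by auto
      then show ?case by (simp add: dist_norm norm_minus_commute)
    qed
  qed
qed

section \<open>The primal-dual forward-backward step\<close>

text \<open>
  The data of the problem with the step-size condition in the form in which it is used: \<open>\<beta>\<close> is a common
  cocoercivity constant of \<open>C\<close> and of the inverses of the \<open>D i\<close>, \<open>s\<close> bounds the coupling relative to the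
  diagonal part of the preconditioner, and \<open>\<rho>\<close> is the resulting coercivity constant.
\<close>

locale primal_dual =
  fixes z :: "'h::{real_inner,complete_space}"
    and \<omega> :: "'i::finite \<Rightarrow> real"
    and A :: "'h \<Rightarrow> 'h set" and C :: "'h \<Rightarrow> 'h"
    and G :: "'i \<Rightarrow> 'g::{real_inner,complete_space} set"
    and r :: "'i \<Rightarrow> 'g"
    and B D :: "'i \<Rightarrow> 'g \<Rightarrow> 'g set" and \<nu> :: "'i \<Rightarrow> real"
    and L :: "'i \<Rightarrow> 'h \<Rightarrow> 'g"
    and \<tau> s \<rho> \<beta> :: real and \<sigma> :: "'i \<Rightarrow> real"
  assumes omega: "\<And>i. 0 < \<omega> i"
    and A: "maximally_monotone_on UNIV A"
    and C: "cocoercive \<beta> C"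
    and G: "\<And>i. hilbert_subspace (G i)"
    and r: "\<And>i. r i \<in> G i"
    and B: "\<And>i. maximally_monotone_on (G i) (B i)"
    and D: "\<And>i. maximally_monotone_on (G i) (D i)" "\<And>i. strongly_monotone (\<nu> i) (D i)"
    and \<nu>: "\<And>i. \<beta> \<le> \<nu> i"
    and L: "\<And>i. bounded_linear (L i)" "\<And>i. range (L i) \<subseteq> G i"
    and tau: "\<tau> > 0" and sigma: "\<And>i. \<sigma> i > 0"
    and s: "s = sqrt (\<tau> * (\<Sum>i\<in>UNIV. \<sigma> i * \<omega> i * (onorm (L i))\<^sup>2))"
    and rho: "\<rho> \<le> inverse \<tau> * (1 - s)" "\<And>i. \<rho> \<le> inverse (\<sigma> i) * (1 - s)" "s < 1"
    and rho_pos: "\<rho> > 0" and beta: "2 * \<rho> * \<beta> > 1"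
begin

definition Dinv :: "'i \<Rightarrow> 'g \<Rightarrow> 'g" where "Dinv i = as_map (inv_op (D i))"

definition Ladj :: "'g ^ 'i \<Rightarrow> 'h" where "Ladj v = (\<Sum>i\<in>UNIV. \<omega> i *\<^sub>R adjoint (L i) (v $ i))"

definition K :: "('h \<times> ('g ^ 'i)) set" where "K = UNIV \<times> prod_space G"

text \<open>
  The weights \<open>\<omega> i\<close> are put into the inner product. With respect to \<open>W\<close>, the map \<open>(x, v) \<mapsto> (Ladj v, - L x)\<close>
  is skew.
\<close>

definition W :: "'h \<times> ('g ^ 'i) \<Rightarrow> 'h \<times> ('g ^ 'i) \<Rightarrow> real" where
  "W u w = fst u \<bullet> fst w + (\<Sum>i\<in>UNIV. \<omega> i * (snd u $ i \<bullet> snd w $ i))"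

text \<open>
  \<open>Q u w = W (P u) w\<close> for the preconditioner \<open>P (x, v) = (x / \<tau> - Ladj v, v\<^sub>i / \<sigma>\<^sub>i - L\<^sub>i x)\<close>.
\<close>

definition Q :: "'h \<times> ('g ^ 'i) \<Rightarrow> 'h \<times> ('g ^ 'i) \<Rightarrow> real" where
  "Q u w = fst u \<bullet> fst w / \<tau>
     + (\<Sum>i\<in>UNIV. \<omega> i * ((snd u $ i \<bullet> snd w $ i) / \<sigma> i
         - L i (fst u) \<bullet> snd w $ i - L i (fst w) \<bullet> snd u $ i))"

definition F :: "'h \<times> ('g ^ 'i) \<Rightarrow> 'h \<times> ('g ^ 'i)" where
  "F u = (C (fst u), \<chi> i. Dinv i (snd u $ i))"

definition pstep :: "'h \<times> ('g ^ 'i) \<Rightarrow> 'h" where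
  "pstep u = resolvent (scale_op \<tau> A) (fst u - \<tau> *\<^sub>R (Ladj (snd u) + C (fst u) - z))"

definition dstep :: "'h \<times> ('g ^ 'i) \<Rightarrow> 'i \<Rightarrow> 'g" where
  "dstep u i = resolvent (scale_op (\<sigma> i) (inv_op (B i)))
     (snd u $ i + \<sigma> i *\<^sub>R (L i (2 *\<^sub>R pstep u - fst u) - Dinv i (snd u $ i) - r i))"

text \<open>
  One step of the algorithm without errors and with relaxation parameter 1.
\<close>

definition T :: "'h \<times> ('g ^ 'i) \<Rightarrow> 'h \<times> ('g ^ 'i)" where
  "T u = (pstep u, \<chi> i. dstep u i)"

lemma G_sub: "subspace (G i)" and G_closed: "closed (G i)"
  using G by (auto simp: hilbert_subspace_def)

lemma L_mem: "L i x \<in> G i"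
  using L(2) by blast

lemma L_linear: "L i (x + y) = L i x + L i y" "L i (x - y) = L i x - L i y" "L i (c *\<^sub>R x) = c *\<^sub>R L i x"
  using bounded_linear.linear[OF L(1)[of i]] by (simp_all add: linear_add linear_diff linear_scale)

lemma K_iff: "u \<in> K \<longleftrightarrow> (\<forall>i. snd u $ i \<in> G i)"
  by (cases u) (simp add: K_def prod_space_def)

lemma K_subspace: "subspace K"
  by (auto simp: subspace_def K_iff intro: subspace_0 subspace_add subspace_scale G_sub)

lemma K_closed: "closed K"
proof -
  have "prod_space G = (\<Inter>i. (\<lambda>v. v $ i) -` G i)" by (auto simp: prod_space_def)
  also have "closed \<dots>" by (intro closed_INT ballI closed_vimage_vec_nth G_closed)
  finally show ?thesis unfolding K_def by (intro closed_Times closed_UNIV)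
qed

lemma Dinv_mem: "v \<in> G i \<Longrightarrow> Dinv i v \<in> G i"
  unfolding Dinv_def by (rule inverse_strongly_monotone_mem[OF G D])

lemma inv_D: "v \<in> G i \<Longrightarrow> inv_op (D i) v = {Dinv i v}"
  unfolding Dinv_def by (rule inverse_strongly_monotone_singleton[OF G D])

lemma Dinv_cocoercive:
  assumes "v \<in> G i" "v' \<in> G i"
  shows "\<beta> * (norm (Dinv i v - Dinv i v'))\<^sup>2 \<le> (Dinv i v - Dinv i v') \<bullet> (v - v')"
proof -
  have "\<beta> * (norm (Dinv i v - Dinv i v'))\<^sup>2 \<le> \<nu> i * (norm (Dinv i v - Dinv i v'))\<^sup>2"
    using \<nu> by (intro mult_right_mono) auto
  also have "\<dots> \<le> (Dinv i v - Dinv i v') \<bullet> (v - v')"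
    unfolding Dinv_def by (rule inverse_strongly_monotone_cocoercive[OF G D assms])
  finally show ?thesis .
qed

lemma inner_Ladj: "x \<bullet> Ladj v = (\<Sum>i\<in>UNIV. \<omega> i * (L i x \<bullet> v $ i))"
  by (simp add: Ladj_def inner_sum_right adjoint_eq[OF L(1)])

text \<open>
  The Cauchy-Schwarz inequality for sums, with \<open>\<omega> i\<close> split as \<open>sqrt (\<sigma> i * \<omega> i) * sqrt (\<omega> i / \<sigma> i)\<close>, followed
  by the arithmetic-geometric mean inequality.
\<close>

lemma Q_cross:
  "2 * \<bar>\<Sum>i\<in>UNIV. \<omega> i * (L i x \<bullet> v $ i)\<bar>
     \<le> s * ((norm x)\<^sup>2 / \<tau> + (\<Sum>i\<in>UNIV. \<omega> i * (norm (v $ i))\<^sup>2 / \<sigma> i))"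
proof -
  define f where "f i = sqrt (\<sigma> i * \<omega> i) * onorm (L i)" for i
  define g where "g i = sqrt (\<omega> i / \<sigma> i) * norm (v $ i)" for i
  define S where "S = (\<Sum>i\<in>UNIV. \<sigma> i * \<omega> i * (onorm (L i))\<^sup>2)"
  define N where "N = (\<Sum>i\<in>UNIV. \<omega> i * (norm (v $ i))\<^sup>2 / \<sigma> i)"
  have w: "0 \<le> \<omega> i" "0 \<le> \<sigma> i" "0 \<le> onorm (L i)" for i
    using omega[of i] sigma[of i] onorm_pos_le[OF L(1)] by auto
  have S: "L2_set f UNIV = sqrt S"
    using w by (simp add: L2_set_def S_def f_def power_mult_distrib)
  have N: "L2_set g UNIV = sqrt N"
    using w by (simp add: L2_set_def N_def g_def power_mult_distrib)
  have N0: "0 \<le> N" unfolding N_def using w by (intro sum_nonneg) simp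
  have fg: "f i * g i = \<omega> i * (onorm (L i) * norm (v $ i))" for i
  proof -
    have "sqrt (\<sigma> i * \<omega> i) * sqrt (\<omega> i / \<sigma> i) = sqrt (\<omega> i * \<omega> i)"
      using sigma[of i] by (simp flip: real_sqrt_mult)
    then show ?thesis unfolding f_def g_def using w[of i] by (simp add: algebra_simps)
  qed
  have "\<bar>\<Sum>i\<in>UNIV. \<omega> i * (L i x \<bullet> v $ i)\<bar> \<le> (\<Sum>i\<in>UNIV. \<bar>\<omega> i * (L i x \<bullet> v $ i)\<bar>)"
    by (rule sum_abs)
  also have "\<dots> \<le> (\<Sum>i\<in>UNIV. norm x * (\<bar>f i\<bar> * \<bar>g i\<bar>))"
  proof (rule sum_mono)
    fix i
    have "\<bar>L i x \<bullet> v $ i\<bar> \<le> norm (L i x) * norm (v $ i)" by (rule Cauchy_Schwarz_ineq2)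
    also have "\<dots> \<le> (onorm (L i) * norm x) * norm (v $ i)"
      by (intro mult_right_mono onorm[OF L(1)]) simp
    finally have "\<omega> i * \<bar>L i x \<bullet> v $ i\<bar> \<le> \<omega> i * ((onorm (L i) * norm x) * norm (v $ i))"
      using w by (intro mult_left_mono) auto
    then show "\<bar>\<omega> i * (L i x \<bullet> v $ i)\<bar> \<le> norm x * (\<bar>f i\<bar> * \<bar>g i\<bar>)"
      using w[of i] fg[of i] by (simp add: abs_mult flip: abs_mult) (simp add: abs_mult mult_ac)
  qed
  also have "\<dots> = norm x * (\<Sum>i\<in>UNIV. \<bar>f i\<bar> * \<bar>g i\<bar>)" by (rule sum_distrib_left[symmetric])
  also have "\<dots> \<le> norm x * (sqrt S * sqrt N)"
    using L2_set_mult_ineq[of f g UNIV] by (intro mult_left_mono) (simp_all add: S N)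
  also have "\<dots> = s * ((norm x / sqrt \<tau>) * sqrt N)"
    using tau by (simp add: s S_def[symmetric] real_sqrt_mult)
  finally have "2 * \<bar>\<Sum>i\<in>UNIV. \<omega> i * (L i x \<bullet> v $ i)\<bar> \<le> 2 * (s * ((norm x / sqrt \<tau>) * sqrt N))"
    by (rule mult_left_mono) simp
  also have "\<dots> = s * (2 * (norm x / sqrt \<tau>) * sqrt N)" by (simp only: mult_ac)
  also have "\<dots> \<le> s * ((norm x / sqrt \<tau>)\<^sup>2 + (sqrt N)\<^sup>2)"
  proof (rule mult_left_mono)
    show "2 * (norm x / sqrt \<tau>) * sqrt N \<le> (norm x / sqrt \<tau>)\<^sup>2 + (sqrt N)\<^sup>2"
      by (rule sum_squares_bound)
    show "0 \<le> s" unfolding s using tau w by (simp add: sum_nonneg)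
  qed
  also have "\<dots> = s * ((norm x)\<^sup>2 / \<tau> + N)" using tau N0 by (simp add: power_divide)
  finally show ?thesis by (simp add: N_def)
qed

lemma Q_diag:
  "Q u u = ((norm (fst u))\<^sup>2 / \<tau> + (\<Sum>i\<in>UNIV. \<omega> i * (norm (snd u $ i))\<^sup>2 / \<sigma> i))
     - 2 * (\<Sum>i\<in>UNIV. \<omega> i * (L i (fst u) \<bullet> snd u $ i))"
  by (simp add: Q_def power2_norm_eq_inner sum_subtractf right_diff_distrib sum_distrib_left mult_ac)

lemma W_diag: "W u u = (norm (fst u))\<^sup>2 + (\<Sum>i\<in>UNIV. \<omega> i * (norm (snd u $ i))\<^sup>2)"
  by (simp add: W_def power2_norm_eq_inner)

lemma Q_bounds:
  defines "N \<equiv> \<lambda>u. (norm (fst u))\<^sup>2 / \<tau> + (\<Sum>i\<in>UNIV. \<omega> i * (norm (snd u $ i))\<^sup>2 / \<sigma> i)"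
  shows "(1 - s) * N u \<le> Q u u" "Q u u \<le> (1 + s) * N u"
proof -
  define X where "X = (\<Sum>i\<in>UNIV. \<omega> i * (L i (fst u) \<bullet> snd u $ i))"
  have "Q u u = N u - 2 * X" "2 * \<bar>X\<bar> \<le> s * N u"
    using Q_cross[of "fst u" "snd u"] by (simp_all add: Q_diag N_def X_def)
  then show "(1 - s) * N u \<le> Q u u" "Q u u \<le> (1 + s) * N u"
    unfolding left_diff_distrib distrib_right by linarith+
qed

lemma W_le_Q: "\<rho> * W u u \<le> Q u u"
proof -
  have "\<rho> * W u u = \<rho> * (norm (fst u))\<^sup>2 + (\<Sum>i\<in>UNIV. \<omega> i * (norm (snd u $ i))\<^sup>2 * \<rho>)"
    by (simp add: W_diag sum_distrib_left sum_distrib_right algebra_simps)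
  also have "\<dots> \<le> inverse \<tau> * (1 - s) * (norm (fst u))\<^sup>2
      + (\<Sum>i\<in>UNIV. \<omega> i * (norm (snd u $ i))\<^sup>2 * (inverse (\<sigma> i) * (1 - s)))"
    using rho omega by (intro add_mono mult_right_mono sum_mono mult_left_mono) (auto simp: less_imp_le)
  also have "\<dots> = (1 - s) * ((norm (fst u))\<^sup>2 / \<tau> + (\<Sum>i\<in>UNIV. \<omega> i * (norm (snd u $ i))\<^sup>2 / \<sigma> i))"
    by (simp add: distrib_left sum_distrib_left divide_inverse mult_ac)
  also have "\<dots> \<le> Q u u" by (rule Q_bounds)
  finally show ?thesis .
qed

definition wmin :: real where "wmin = Min (insert 1 (range \<omega>))"

lemma wmin: "0 < wmin" "wmin \<le> 1" "wmin \<le> \<omega> i"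
proof -
  show "0 < wmin" using omega by (auto simp: wmin_def)
  show "wmin \<le> 1" "wmin \<le> \<omega> i" unfolding wmin_def by (intro Min_le; simp)+
qed

lemma norm_le_W: "wmin * (norm u)\<^sup>2 \<le> W u u"
proof -
  have "wmin * (norm u)\<^sup>2 = wmin * (norm (fst u))\<^sup>2 + (\<Sum>i\<in>UNIV. wmin * (norm (snd u $ i))\<^sup>2)"
    by (simp add: norm_pair_sq norm_vec_sq distrib_left sum_distrib_left)
  also have "\<dots> \<le> 1 * (norm (fst u))\<^sup>2 + (\<Sum>i\<in>UNIV. \<omega> i * (norm (snd u $ i))\<^sup>2)"
    using wmin by (intro add_mono mult_right_mono sum_mono) auto
  finally show ?thesis by (simp add: W_diag)
qed

lemma Q_upper: "Q u u \<le> (1 + s) * (1 / \<tau> + (\<Sum>i\<in>UNIV. \<omega> i / \<sigma> i)) * (norm u)\<^sup>2"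
proof -
  let ?N = "(norm (fst u))\<^sup>2 / \<tau> + (\<Sum>i\<in>UNIV. \<omega> i * (norm (snd u $ i))\<^sup>2 / \<sigma> i)"
  have s0: "0 \<le> s" unfolding s using tau omega sigma
    by (simp add: sum_nonneg less_imp_le)
  have "Q u u \<le> (1 + s) * ?N" by (rule Q_bounds)
  also have "\<dots> \<le> (1 + s) * (1 / \<tau> * (norm u)\<^sup>2 + (\<Sum>i\<in>UNIV. \<omega> i / \<sigma> i * (norm u)\<^sup>2))"
  proof (intro mult_left_mono add_mono sum_mono)
    have n: "(norm (snd u))\<^sup>2 \<le> (norm u)\<^sup>2" "(norm (fst u))\<^sup>2 \<le> (norm u)\<^sup>2" by (simp_all add: norm_pair_sq)
    show "(norm (fst u))\<^sup>2 / \<tau> \<le> 1 / \<tau> * (norm u)\<^sup>2" using n tau by (simp add: divide_right_mono)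
    fix i
    have "(norm (snd u $ i))\<^sup>2 \<le> (norm (snd u))\<^sup>2"
      by (intro power_mono Finite_Cartesian_Product.norm_nth_le) auto
    then have "\<omega> i / \<sigma> i * (norm (snd u $ i))\<^sup>2 \<le> \<omega> i / \<sigma> i * (norm u)\<^sup>2"
      using n omega[of i] sigma[of i] by (intro mult_left_mono) auto
    then show "\<omega> i * (norm (snd u $ i))\<^sup>2 / \<sigma> i \<le> \<omega> i / \<sigma> i * (norm u)\<^sup>2" by simp
  qed (use s0 in auto)
  also have "\<dots> = (1 + s) * (1 / \<tau> + (\<Sum>i\<in>UNIV. \<omega> i / \<sigma> i)) * (norm u)\<^sup>2"
    by (simp only: distrib_right mult.assoc sum_distrib_right)
  finally show ?thesis .
qed

sublocale H: hilbert_form K Q "\<rho> * wmin" "(1 + s) * (1 / \<tau> + (\<Sum>i\<in>UNIV. \<omega> i / \<sigma> i))"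
proof
  show "Q a b = Q b a" for a b by (simp add: Q_def inner_commute algebra_simps)
  show "Q (a + b) c = Q a c + Q b c" for a b c
    by (simp add: Q_def L_linear inner_add_left inner_add_right sum.distrib[symmetric]
        add_divide_distrib algebra_simps)
  show "Q (t *\<^sub>R a) c = t * Q a c" for t a c
    by (simp add: Q_def L_linear sum_distrib_left algebra_simps)
  show "\<rho> * wmin * (norm a)\<^sup>2 \<le> Q a a" for a
  proof -
    have "\<rho> * (wmin * (norm a)\<^sup>2) \<le> \<rho> * W a a"
      using rho_pos by (intro mult_left_mono norm_le_W) auto
    then show ?thesis using W_le_Q[of a] by simp
  qed
  show "0 < \<rho> * wmin" using rho_pos wmin by simp
qed (rule K_subspace K_closed Q_upper)+

lemma pstep_iff:
  "pstep u = p \<longleftrightarrow> (1/\<tau>) *\<^sub>R (fst u - p) - Ladj (snd u) - C (fst u) + z \<in> A p"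
proof -
  have V: "hilbert_subspace (UNIV :: 'h set)" by (simp add: hilbert_subspace_def)
  have eq: "(1/\<tau>) *\<^sub>R ((fst u - \<tau> *\<^sub>R (Ladj (snd u) + C (fst u) - z)) - p)
      = (1/\<tau>) *\<^sub>R (fst u - p) - Ladj (snd u) - C (fst u) + z"
    using tau by (simp add: algebra_simps)
  show ?thesis unfolding pstep_def resolvent_eq_iff[OF V A tau UNIV_I] eq ..
qed

lemma dstep_arg_mem:
  assumes "u \<in> K"
  shows "snd u $ i + \<sigma> i *\<^sub>R (L i x - Dinv i (snd u $ i) - r i) \<in> G i"
  using assms r[of i] L_mem[of i x] Dinv_mem[of "snd u $ i" i] G_sub[of i] unfolding K_iff
  by (intro subspace_add subspace_scale subspace_diff) auto

lemma dstep_iff: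
  assumes "u \<in> K"
  shows "dstep u i = q \<longleftrightarrow>
    q \<in> B i ((1/\<sigma> i) *\<^sub>R (snd u $ i - q) + L i (2 *\<^sub>R pstep u - fst u) - Dinv i (snd u $ i) - r i)"
proof -
  have eq: "(1/\<sigma> i) *\<^sub>R ((snd u $ i + \<sigma> i *\<^sub>R (L i x - Dinv i (snd u $ i) - r i)) - q)
      = (1/\<sigma> i) *\<^sub>R (snd u $ i - q) + L i x - Dinv i (snd u $ i) - r i" for x
    using sigma[of i] by (simp add: algebra_simps)
  show ?thesis
    unfolding dstep_def resolvent_eq_iff[OF G maximally_monotone_inv[OF B] sigma dstep_arg_mem[OF assms]] eq
    by (simp add: inv_op_def)
qed

lemma T_mem:
  assumes "u \<in> K"
  shows "T u \<in> K"
  unfolding K_iff T_def dstep_def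
  using resolvent_mem(2)[OF G maximally_monotone_inv[OF B] sigma dstep_arg_mem[OF assms]] by simp

text \<open>
  Add the monotonicity inequality of \<open>A\<close> at the two primal steps and, with weight \<open>\<omega> i\<close>, those of the
  \<open>B i\<close> at the dual steps. The coupling terms carry \<open>2 p - x\<close> on the dual side only, and this is just what
  reassembles them into the symmetric form \<open>Q\<close>.
\<close>

lemma T_monotone:
  assumes u: "u \<in> K" and w: "w \<in> K"
  shows "W (F u - F w) (T u - T w) \<le> Q ((u - w) - (T u - T w)) (T u - T w)"
proof -
  define p where "p = pstep u - pstep w"
  define q where "q i = dstep u i - dstep w i" for i
  define d where "d i = Dinv i (snd u $ i) - Dinv i (snd w $ i)" for i
  define c where "c = C (fst u) - C (fst w)"
  define x where "x = fst u - fst w"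
  define v where "v = snd u - snd w"
  have p: "0 \<le> p \<bullet> ((1/\<tau>) *\<^sub>R (x - p) - Ladj v - c)"
  proof -
    have mem: "(1/\<tau>) *\<^sub>R (fst u - pstep u) - Ladj (snd u) - C (fst u) + z \<in> A (pstep u)" for u
      using pstep_iff by blast
    have "0 \<le> p \<bullet> (((1/\<tau>) *\<^sub>R (fst u - pstep u) - Ladj (snd u) - C (fst u) + z)
        - ((1/\<tau>) *\<^sub>R (fst w - pstep w) - Ladj (snd w) - C (fst w) + z))"
      using A mem[of u] mem[of w] unfolding maximally_monotone_on_iff p_def by blast
    also have "((1/\<tau>) *\<^sub>R (fst u - pstep u) - Ladj (snd u) - C (fst u) + z)
        - ((1/\<tau>) *\<^sub>R (fst w - pstep w) - Ladj (snd w) - C (fst w) + z)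
        = (1/\<tau>) *\<^sub>R (x - p) - (Ladj (snd u) - Ladj (snd w)) - c"
      by (simp add: x_def p_def c_def algebra_simps)
    finally show ?thesis by (simp add: v_def inner_diff_right inner_Ladj algebra_simps sum_subtractf)
  qed
  have q: "0 \<le> q i \<bullet> ((1/\<sigma> i) *\<^sub>R (v $ i - q i) + L i (2 *\<^sub>R p - x) - d i)" for i
  proof -
    let ?y = "\<lambda>u. (1/\<sigma> i) *\<^sub>R (snd u $ i - dstep u i) + L i (2 *\<^sub>R pstep u - fst u) - Dinv i (snd u $ i) - r i"
    have mem: "dstep u i \<in> B i (?y u)" if "u \<in> K" for u
      using dstep_iff[OF that] by blast
    have "0 \<le> (?y u - ?y w) \<bullet> q i"
      using B[of i] mem[OF u] mem[OF w] unfolding maximally_monotone_on_iff q_def by blast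
    also have "?y u - ?y w = (1/\<sigma> i) *\<^sub>R (v $ i - q i) + L i (2 *\<^sub>R p - x) - d i"
      by (simp add: x_def p_def d_def v_def q_def L_linear algebra_simps)
    finally show ?thesis by (simp only: inner_commute[of _ "q i"])
  qed
  have "0 \<le> p \<bullet> ((1/\<tau>) *\<^sub>R (x - p) - Ladj v - c)
      + (\<Sum>i\<in>UNIV. \<omega> i * (q i \<bullet> ((1/\<sigma> i) *\<^sub>R (v $ i - q i) + L i (2 *\<^sub>R p - x) - d i)))"
    using p q omega by (intro add_nonneg_nonneg sum_nonneg mult_nonneg_nonneg) (auto simp: less_imp_le)
  also have "p \<bullet> ((1/\<tau>) *\<^sub>R (x - p) - Ladj v - c)
      = (x - p) \<bullet> p / \<tau> - c \<bullet> p - (\<Sum>i\<in>UNIV. \<omega> i * (L i p \<bullet> v $ i))"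
    by (simp add: inner_diff_right inner_diff_left inner_Ladj inner_commute[of p c] inner_commute[of p x]
        diff_divide_distrib)
  also have "\<dots> + (\<Sum>i\<in>UNIV. \<omega> i * (q i \<bullet> ((1/\<sigma> i) *\<^sub>R (v $ i - q i) + L i (2 *\<^sub>R p - x) - d i)))
      = (x - p) \<bullet> p / \<tau> - c \<bullet> p
        + (\<Sum>i\<in>UNIV. \<omega> i * (q i \<bullet> ((1/\<sigma> i) *\<^sub>R (v $ i - q i) + L i (2 *\<^sub>R p - x) - d i)
                              - L i p \<bullet> v $ i))"
    by (simp add: right_diff_distrib sum_subtractf)
  also have "(\<Sum>i\<in>UNIV. \<omega> i * (q i \<bullet> ((1/\<sigma> i) *\<^sub>R (v $ i - q i) + L i (2 *\<^sub>R p - x) - d i) - L i p \<bullet> v $ i))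
      = (\<Sum>i\<in>UNIV. \<omega> i * (((v $ i - q i) \<bullet> q i) / \<sigma> i - L i (x - p) \<bullet> q i - L i p \<bullet> (v $ i - q i)) - \<omega> i * (d i \<bullet> q i))"
  proof (rule sum.cong)
    fix i
    have "q i \<bullet> ((1/\<sigma> i) *\<^sub>R (v $ i - q i) + L i (2 *\<^sub>R p - x) - d i)
        = (v $ i - q i) \<bullet> q i / \<sigma> i + L i (2 *\<^sub>R p - x) \<bullet> q i - d i \<bullet> q i"
      by (simp only: inner_diff_right[of _ _ "d i"] inner_add_right inner_scaleR_right inner_commute[of "q i"]) simp
    moreover have "L i (2 *\<^sub>R p - x) \<bullet> q i - L i p \<bullet> v $ i = - (L i (x - p) \<bullet> q i) - L i p \<bullet> (v $ i - q i)"
      by (simp add: L_linear inner_diff_left inner_diff_right)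
    ultimately show "\<omega> i * (q i \<bullet> ((1/\<sigma> i) *\<^sub>R (v $ i - q i) + L i (2 *\<^sub>R p - x) - d i) - L i p \<bullet> v $ i)
      = \<omega> i * (((v $ i - q i) \<bullet> q i) / \<sigma> i - L i (x - p) \<bullet> q i - L i p \<bullet> (v $ i - q i)) - \<omega> i * (d i \<bullet> q i)"
      by (simp only: right_diff_distrib[symmetric]) simp
  qed simp
  also have "(x - p) \<bullet> p / \<tau> - c \<bullet> p + \<dots> = Q ((u - w) - (T u - T w)) (T u - T w) - W (F u - F w) (T u - T w)"
    by (simp add: Q_def W_def F_def T_def sum_subtractf x_def v_def p_def q_def c_def d_def)
  finally show ?thesis by simp
qed

lemma F_cocoercive:
  assumes u: "u \<in> K" and w: "w \<in> K"
  shows "\<beta> * W (F u - F w) (F u - F w) \<le> W (F u - F w) (u - w)"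
proof -
  have 1: "\<beta> * (norm (C (fst u) - C (fst w)))\<^sup>2 \<le> (C (fst u) - C (fst w)) \<bullet> (fst u - fst w)"
    using C unfolding cocoercive_def by (metis inner_commute)
  have 2: "\<omega> i * (\<beta> * (norm (Dinv i (snd u $ i) - Dinv i (snd w $ i)))\<^sup>2)
      \<le> \<omega> i * ((Dinv i (snd u $ i) - Dinv i (snd w $ i)) \<bullet> (snd u $ i - snd w $ i))" for i
    using Dinv_cocoercive u w omega[of i] unfolding K_iff by (intro mult_left_mono) auto
  have "\<beta> * W (F u - F w) (F u - F w) = \<beta> * (norm (C (fst u) - C (fst w)))\<^sup>2
     + (\<Sum>i\<in>UNIV. \<omega> i * (\<beta> * (norm (Dinv i (snd u $ i) - Dinv i (snd w $ i)))\<^sup>2))"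
    by (simp add: W_diag F_def distrib_left sum_distrib_left mult_ac)
  also have "\<dots> \<le> W (F u - F w) (u - w)"
    using add_mono[OF 1 sum_mono[OF 2]] by (simp add: W_def F_def)
  finally show ?thesis .
qed

lemma W_diff_right: "W a (b - c) = W a b - W a c"
  by (simp add: W_def inner_diff_right right_diff_distrib sum_subtractf)

lemma W_nonneg: "0 \<le> W a a"
  unfolding W_diag using omega
  by (intro add_nonneg_nonneg sum_nonneg mult_nonneg_nonneg) (auto simp: less_imp_le)

lemma W_Young:
  assumes "k > 0"
  shows "W a b \<le> k * W a a + W b b / (4 * k)"
proof -
  have "W a b \<le> (k * (norm (fst a))\<^sup>2 + (norm (fst b))\<^sup>2 / (4 * k))
      + (\<Sum>i\<in>UNIV. \<omega> i * (k * (norm (snd a $ i))\<^sup>2 + (norm (snd b $ i))\<^sup>2 / (4 * k)))"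
    unfolding W_def using omega
    by (intro add_mono sum_mono mult_left_mono inner_Young assms) (auto simp: less_imp_le)
  also have "\<dots> = k * W a a + W b b / (4 * k)"
    by (simp add: W_diag distrib_left sum.distrib sum_distrib_left sum_divide_distrib add_divide_distrib mult_ac)
  finally show ?thesis .
qed

text \<open>
  The midpoint between \<open>1 / (2 \<rho>)\<close> and \<open>\<beta>\<close>. As the parameter in Young's inequality, it leaves a positive
  share both of the residual and of the cocoercivity term.
\<close>

definition k0 :: real where "k0 = (\<beta> + 1 / (2 * \<rho>)) / 2"

lemma k0: "0 < k0" "k0 < \<beta>" "1 < 2 * k0 * \<rho>"
proof -
  have "1 / (2 * \<rho>) < \<beta>" using beta rho_pos by (simp add: field_simps)
  then show "k0 < \<beta>" by (simp add: k0_def)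
  have "1 / (2 * \<rho>) < k0" using \<open>1 / (2 * \<rho>) < \<beta>\<close> by (simp add: k0_def)
  then show "1 < 2 * k0 * \<rho>" using rho_pos by (simp add: field_simps)
  show "0 < k0" using \<open>1 / (2 * \<rho>) < k0\<close> rho_pos by (meson less_trans zero_less_divide_1_iff mult_pos_pos zero_less_numeral)
qed

text \<open>
  Here \<open>F\<close> is evaluated at \<open>u\<close>, but monotonicity pairs it with \<open>T u\<close>. Young's inequality pays for the
  difference: part of the cocoercivity term and, through \<open>\<rho> W \<le> Q\<close>, part of the squared residual.
\<close>

lemma T_averaged:
  assumes u: "u \<in> K" and w: "w \<in> K"
  shows "Q (T u - T w) (T u - T w)
      + (1 - 1 / (2 * k0 * \<rho>)) * Q ((u - T u) - (w - T w)) ((u - T u) - (w - T w))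
      + 2 * (\<beta> - k0) * W (F u - F w) (F u - F w) \<le> Q (u - w) (u - w)"
proof -
  let ?c = "F u - F w" and ?t = "T u - T w"
  define d where "d = (u - w) - ?t"
  have d: "(u - T u) - (w - T w) = d" by (simp add: d_def)
  have "\<beta> * W ?c ?c - (k0 * W ?c ?c + W d d / (4 * k0)) \<le> W ?c (u - w) - W ?c d"
    using F_cocoercive[OF u w] W_Young[OF k0(1), of ?c d] by linarith
  also have "\<dots> = W ?c ?t" by (simp add: d_def W_diff_right)
  also have "\<dots> \<le> Q d ?t" unfolding d_def by (rule T_monotone[OF u w])
  finally have 1: "(\<beta> - k0) * W ?c ?c - W d d / (4 * k0) \<le> Q d ?t" by (simp add: left_diff_distrib)
  have "W d d / (4 * k0) \<le> (Q d d / \<rho>) / (4 * k0)"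
    using W_le_Q[of d] rho_pos k0(1) by (intro divide_right_mono) (auto simp: field_simps)
  then have 2: "2 * (W d d / (4 * k0)) \<le> 1 / (2 * k0 * \<rho>) * Q d d" by (simp add: field_simps)
  have "Q (u - w) (u - w) = Q (d + ?t) (d + ?t)" by (simp add: d_def)
  also have "\<dots> = Q d d + 2 * Q d ?t + Q ?t ?t"
    by (simp only: H.bil.add_left H.bil.add_right H.sym[of ?t d])
  finally show ?thesis unfolding d using 1 2 by (simp add: left_diff_distrib)
qed

lemma mem_parallel_sum:
  "v \<in> parallel_sum (B i) (D i) y \<longleftrightarrow> v \<in> G i \<and> v \<in> B i (y - Dinv i v)"
proof -
  have BG: "v \<in> G i" if "v \<in> B i a" for a
    using B[of i] that unfolding maximally_monotone_on_iff by blast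
  have "v \<in> parallel_sum (B i) (D i) y \<longleftrightarrow> y \<in> {a. v \<in> B i a} + inv_op (D i) v"
    by (simp add: parallel_sum_def inv_op_def)
  also have "\<dots> \<longleftrightarrow> v \<in> G i \<and> v \<in> B i (y - Dinv i v)"
  proof
    assume "y \<in> {a. v \<in> B i a} + inv_op (D i) v"
    then obtain a b where ab: "y = a + b" "v \<in> B i a" "b \<in> inv_op (D i) v"
      by (auto elim: set_plus_elim)
    then have "v \<in> G i" using BG by blast
    with ab show "v \<in> G i \<and> v \<in> B i (y - Dinv i v)" by (simp add: inv_D)
  next
    assume v: "v \<in> G i \<and> v \<in> B i (y - Dinv i v)"
    then have "(y - Dinv i v) + Dinv i v \<in> {a. v \<in> B i a} + inv_op (D i) v"
      by (intro set_plus_intro) (auto simp: inv_D)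
    then show "y \<in> {a. v \<in> B i a} + inv_op (D i) v" by simp
  qed
  finally show ?thesis .
qed

text \<open>
  At a fixed point the residuals in both resolvent inclusions vanish and \<open>2 p - x = x\<close>; what remains is the
  pair of inclusions that defines a dual solution with its primal companion.
\<close>

lemma fixed_point_iff:
  "(x, v) \<in> K \<and> T (x, v) = (x, v) \<longleftrightarrow>
     z - Ladj v - C x \<in> A x \<and> (\<forall>i. v $ i \<in> parallel_sum (B i) (D i) (L i x - r i))"
proof (cases "(x, v) \<in> K")
  case True
  have "T (x, v) = (x, v) \<longleftrightarrow> pstep (x, v) = x \<and> (\<forall>i. dstep (x, v) i = v $ i)"
    by (auto simp: T_def vec_eq_iff)
  also have "\<dots> \<longleftrightarrow> pstep (x, v) = x \<and> (\<forall>i. v $ i \<in> B i (L i x - r i - Dinv i (v $ i)))"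
    using dstep_iff[OF True] by (auto simp: scaleR_2 algebra_simps)
  also have "pstep (x, v) = x \<longleftrightarrow> z - Ladj v - C x \<in> A x"
    by (simp add: pstep_iff algebra_simps)
  finally show ?thesis using True by (auto simp: mem_parallel_sum K_iff)
next
  case False
  then show ?thesis by (auto simp: mem_parallel_sum K_iff)
qed

lemma mem_weighted_sum:
  "y \<in> (\<Sum>i\<in>UNIV. (\<lambda>v. \<omega> i *\<^sub>R adjoint (L i) v) ` S i) \<longleftrightarrow> (\<exists>v. y = Ladj v \<and> (\<forall>i. v $ i \<in> S i))"
proof
  assume "y \<in> (\<Sum>i\<in>UNIV. (\<lambda>v. \<omega> i *\<^sub>R adjoint (L i) v) ` S i)"
  then obtain f where f: "y = sum f UNIV" "\<forall>i. f i \<in> (\<lambda>v. \<omega> i *\<^sub>R adjoint (L i) v) ` S i"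
    by (auto simp: set_sum_alt)
  then obtain g where g: "\<And>i. g i \<in> S i" "\<And>i. f i = \<omega> i *\<^sub>R adjoint (L i) (g i)"
    unfolding image_iff by metis
  show "\<exists>v. y = Ladj v \<and> (\<forall>i. v $ i \<in> S i)"
    by (rule exI[of _ "\<chi> i. g i"]) (simp add: Ladj_def f g)
qed (auto simp: set_sum_alt Ladj_def)

text \<open>
  One and the same pair solves both problems: the dual inclusions, with the second one inserted into the
  first, are the primal inclusion.
\<close>

lemma solutions_of_fixed_point:
  assumes "u \<in> K" "T u = u"
  shows "fst u \<in> primal_solutions z A C \<omega> L B D r" "snd u \<in> dual_solutions z A C G \<omega> L B D r"
proof -
  obtain x v where u: "u = (x, v)" by (cases u)
  have A': "z - Ladj v - C x \<in> A x" and v: "v $ i \<in> parallel_sum (B i) (D i) (L i x - r i)" for i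
    using assms fixed_point_iff[of x v] by (auto simp: u)
  have "Ladj v \<in> (\<Sum>i\<in>UNIV. (\<lambda>v. \<omega> i *\<^sub>R adjoint (L i) v) ` parallel_sum (B i) (D i) (L i x - r i))"
    unfolding mem_weighted_sum using v by (intro exI[of _ v]) simp
  then have "(z - Ladj v - C x) + Ladj v + C x \<in> primal_op A C \<omega> L B D r x"
    unfolding primal_op_def by (intro set_plus_intro A' singletonI)
  then show "fst u \<in> primal_solutions z A C \<omega> L B D r"
    by (simp add: primal_solutions_def u)
  have "(z - Ladj v - C x) + C x \<in> A x + {C x}" by (intro set_plus_intro A' singletonI)
  then show "snd u \<in> dual_solutions z A C G \<omega> L B D r"
    using v assms(1) by (auto simp: dual_solutions_def u K_def Ladj_def)
qed

lemma fixed_point_exists: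
  assumes "z \<in> ran_op (primal_op A C \<omega> L B D r)"
  obtains u where "u \<in> K" "T u = u"
proof -
  obtain x where "z \<in> primal_op A C \<omega> L B D r x" using assms by (auto simp: ran_op_def)
  then obtain a v where "z = a + Ladj v + C x" "a \<in> A x"
      "\<forall>i. v $ i \<in> parallel_sum (B i) (D i) (L i x - r i)"
    unfolding primal_op_def by (auto elim!: set_plus_elim simp: mem_weighted_sum)
  then show thesis using that[of "(x, v)"] fixed_point_iff[of x v] by (simp add: algebra_simps)
qed

text \<open>
  Resolvents are nonexpansive, so an error inside a resolvent counts at most with its own norm. The
  primal error enters the dual step again, doubled, through \<open>2 p - x\<close>.
\<close>

lemma perturbed_step:
  assumes u: "u \<in> K" and c: "\<And>i. c i \<in> G i"
    and p: "p = resolvent (scale_op \<tau> A) (fst u - \<tau> *\<^sub>R (Ladj (snd u) + C (fst u) + a1 - z)) + a2"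
    and q: "\<And>i. q $ i = resolvent (scale_op (\<sigma> i) (inv_op (B i)))
      (snd u $ i + \<sigma> i *\<^sub>R (L i (2 *\<^sub>R p - fst u) - Dinv i (snd u $ i) - c i - r i)) + b i"
  shows "norm ((p, q) - T u) \<le> (\<tau> * norm a1 + norm a2)
      + (\<Sum>i\<in>UNIV. \<sigma> i * (onorm (L i) * (2 * (\<tau> * norm a1 + norm a2)) + norm (c i)) + norm (b i))"
proof -
  have P: "norm (p - pstep u) \<le> \<tau> * norm a1 + norm a2"
  proof -
    let ?R = "resolvent (scale_op \<tau> A)"
    let ?w = "fst u - \<tau> *\<^sub>R (Ladj (snd u) + C (fst u) - z)"
    have w: "fst u - \<tau> *\<^sub>R (Ladj (snd u) + C (fst u) + a1 - z) = ?w - \<tau> *\<^sub>R a1" by (simp add: algebra_simps)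
    have V: "hilbert_subspace (UNIV :: 'h set)" by (simp add: hilbert_subspace_def)
    have "p - pstep u = (?R (?w - \<tau> *\<^sub>R a1) - ?R ?w) + a2" unfolding p pstep_def w by simp
    then have "norm (p - pstep u) \<le> norm (?R (?w - \<tau> *\<^sub>R a1) - ?R ?w) + norm a2"
      using norm_triangle_ineq by metis
    also have "norm (?R (?w - \<tau> *\<^sub>R a1) - ?R ?w) \<le> norm ((?w - \<tau> *\<^sub>R a1) - ?w)"
      by (rule resolvent_nonexpansive[OF V A tau]) simp_all
    also have "\<dots> = \<tau> * norm a1" using tau by simp
    finally show ?thesis by simp
  qed
  have R: "norm (q $ i - dstep u i)
      \<le> \<sigma> i * (onorm (L i) * (2 * (\<tau> * norm a1 + norm a2)) + norm (c i)) + norm (b i)" for i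
  proof -
    let ?R = "resolvent (scale_op (\<sigma> i) (inv_op (B i)))"
    let ?w = "snd u $ i + \<sigma> i *\<^sub>R (L i (2 *\<^sub>R pstep u - fst u) - Dinv i (snd u $ i) - r i)"
    let ?w' = "snd u $ i + \<sigma> i *\<^sub>R (L i (2 *\<^sub>R p - fst u) - Dinv i (snd u $ i) - c i - r i)"
    have diff: "?w' - ?w = \<sigma> i *\<^sub>R (L i (2 *\<^sub>R (p - pstep u)) - c i)"
      by (simp add: L_linear algebra_simps)
    have w: "?w \<in> G i" using dstep_arg_mem[OF u] .
    have "?w' = ?w + \<sigma> i *\<^sub>R (L i (2 *\<^sub>R (p - pstep u)) - c i)" using diff by (simp only: diff_eq_eq add.commute)
    also have "\<dots> \<in> G i"
      by (intro subspace_add[OF G_sub w] subspace_scale[OF G_sub] subspace_diff[OF G_sub] L_mem c)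
    finally have w': "?w' \<in> G i" .
    have "norm (L i (2 *\<^sub>R (p - pstep u)) - c i) \<le> norm (L i (2 *\<^sub>R (p - pstep u))) + norm (c i)"
      by (rule norm_triangle_ineq4)
    also have "norm (L i (2 *\<^sub>R (p - pstep u))) \<le> onorm (L i) * norm (2 *\<^sub>R (p - pstep u))"
      by (rule onorm[OF L(1)])
    also have "\<dots> \<le> onorm (L i) * (2 * (\<tau> * norm a1 + norm a2))"
      using P onorm_pos_le[OF L(1)] by (intro mult_left_mono) auto
    finally have n: "norm (?w' - ?w) \<le> \<sigma> i * (onorm (L i) * (2 * (\<tau> * norm a1 + norm a2)) + norm (c i))"
      unfolding diff using sigma[of i] by simp
    have "q $ i - dstep u i = (?R ?w' - ?R ?w) + b i" by (simp add: q dstep_def)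
    then have "norm (q $ i - dstep u i) \<le> norm (?R ?w' - ?R ?w) + norm (b i)"
      using norm_triangle_ineq by metis
    also have "norm (?R ?w' - ?R ?w) \<le> norm (?w' - ?w)"
      by (rule resolvent_nonexpansive[OF G maximally_monotone_inv[OF B] sigma w' w])
    finally show ?thesis using n by linarith
  qed
  have "norm ((p, q) - T u) \<le> norm (p - pstep u) + norm (q - snd (T u))"
    using norm_Pair_le[of "p - pstep u" "q - snd (T u)"] by (simp add: T_def)
  also have "norm (q - snd (T u)) \<le> (\<Sum>i\<in>UNIV. norm (q $ i - dstep u i))"
    unfolding norm_vec_def T_def by (rule order_trans[OF L2_set_le_sum]) simp_all
  also have "norm (p - pstep u) + \<dots> \<le> (\<tau> * norm a1 + norm a2)
      + (\<Sum>i\<in>UNIV. \<sigma> i * (onorm (L i) * (2 * (\<tau> * norm a1 + norm a2)) + norm (c i)) + norm (b i))"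
    by (intro add_mono sum_mono P R)
  finally show ?thesis by simp
qed

text \<open>
  Weak convergence in the sense of \<open>Q\<close> becomes weak convergence of the two components by representing the
  coordinate functionals through \<open>Q\<close>. Strong convergence comes from the remainder term: it forces
  \<open>F (u n) \<longlonglongrightarrow> F l\<close> in norm.
\<close>

theorem perturbed_iteration_converges:
  assumes uK: "\<And>n. u n \<in> K"
    and fp: "u0 \<in> K" "T u0 = u0"
    and step: "\<And>n. norm (u (Suc n) - (u n + lam n *\<^sub>R (T (u n) - u n))) \<le> e n" "summable e"
    and eps: "\<epsilon> > 0" and lam: "\<And>n. \<epsilon> \<le> lam n \<and> lam n \<le> 1"
  obtains l where "l \<in> K" "T l = l"
    "weakly_converges_in UNIV (\<lambda>n. fst (u n)) (fst l)"
    "weakly_converges_in (prod_space G) (\<lambda>n. snd (u n)) (snd l)"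
    "uniformly_monotone_at (\<lambda>w. {C w}) (fst l) \<Longrightarrow> (\<lambda>n. fst (u n)) \<longlonglongrightarrow> fst l"
    "\<And>j. uniformly_monotone_at (inv_op (D j)) (snd l $ j) \<Longrightarrow> (\<lambda>n. snd (u n) $ j) \<longlonglongrightarrow> snd l $ j"
proof -
  let ?R = "\<lambda>u w. 2 * (\<beta> - k0) * W (F u - F w) (F u - F w)"
  have \<kappa>: "0 < 1 - 1 / (2 * k0 * \<rho>)" using k0 by (simp add: field_simps)
  have R0: "0 \<le> ?R u w" for u w using k0 W_nonneg by simp
  obtain l where l: "l \<in> K" "T l = l" and weak: "\<And>w. w \<in> K \<Longrightarrow> (\<lambda>n. Q (u n) w) \<longlonglongrightarrow> Q l w"
    and Rlim: "(\<lambda>n. ?R (u n) l) \<longlonglongrightarrow> 0" and bdd: "bounded (range u)"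
    by (rule H.averaged_iteration_converges[of T "1 - 1 / (2 * k0 * \<rho>)" ?R u u0 lam e \<epsilon>,
        OF T_mem T_averaged \<kappa> R0 uK fp step eps lam]) (assumption+, rule that)
  \<comment> \<open>Every bounded functional converges along the iterates, being represented by \<open>Q\<close>.\<close>
  have functional: "(\<lambda>n. f (u n)) \<longlonglongrightarrow> f l"
    if f: "\<And>x y. f (x + y) = f x + f y" "\<And>t x. f (t *\<^sub>R x) = t * f x" "\<And>x. \<bar>f x\<bar> \<le> N * norm x"
    for f N
  proof -
    obtain w where w: "w \<in> K" "\<And>x. x \<in> K \<Longrightarrow> Q w x = f x"
      by (rule H.representation[of f N]) (simp_all add: f)
    have "(\<lambda>n. Q (u n) w) = (\<lambda>n. f (u n))" "Q l w = f l"
      using w(2)[OF uK] w(2)[OF l(1)] H.sym[of w] by simp_all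
    then show ?thesis using weak[OF w(1)] by simp
  qed
  have weak1: "weakly_converges_in UNIV (\<lambda>n. fst (u n)) (fst l)"
    unfolding weakly_converges_in_def
  proof
    fix h :: 'h
    have "\<bar>fst x \<bullet> h\<bar> \<le> norm h * norm x" for x :: "'h \<times> ('g ^ 'i)"
    proof -
      have "\<bar>fst x \<bullet> h\<bar> \<le> norm (fst x) * norm h" by (rule Cauchy_Schwarz_ineq2)
      also have "\<dots> \<le> norm x * norm h" by (intro mult_right_mono norm_proj_le) simp
      finally show ?thesis by (simp add: mult.commute)
    qed
    then show "(\<lambda>n. fst (u n) \<bullet> h) \<longlonglongrightarrow> fst l \<bullet> h"
      using functional[of "\<lambda>x. fst x \<bullet> h" "norm h"] by (simp add: inner_add_left)
  qed
  have weak2: "weakly_converges_in (prod_space G) (\<lambda>n. snd (u n)) (snd l)"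
    unfolding weakly_converges_in_def
  proof
    fix h :: "'g ^ 'i"
    have "\<bar>snd x \<bullet> h\<bar> \<le> norm h * norm x" for x :: "'h \<times> ('g ^ 'i)"
    proof -
      have "\<bar>snd x \<bullet> h\<bar> \<le> norm (snd x) * norm h" by (rule Cauchy_Schwarz_ineq2)
      also have "\<dots> \<le> norm x * norm h" by (intro mult_right_mono norm_proj_le) simp
      finally show ?thesis by (simp add: mult.commute)
    qed
    then show "(\<lambda>n. snd (u n) \<bullet> h) \<longlonglongrightarrow> snd l \<bullet> h"
      using functional[of "\<lambda>x. snd x \<bullet> h" "norm h"] by (simp add: inner_add_left)
  qed
  have Wlim: "(\<lambda>n. W (F (u n) - F l) (F (u n) - F l)) \<longlonglongrightarrow> 0"
    using tendsto_mult_right_zero[OF Rlim, of "1 / (2 * (\<beta> - k0))"] k0(2) by simp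
  have bdd1: "bounded (range (\<lambda>n. fst l - fst (u n)))" and bdd2: "bounded (range (\<lambda>n. snd l $ j - snd (u n) $ j))" for j
  proof -
    obtain N where N: "\<And>n. norm (u n) \<le> N" using bdd by (auto simp: bounded_iff)
    have "norm (fst l - fst (u n)) \<le> norm (fst l) + N" for n
      using norm_triangle_ineq4[of "fst l" "fst (u n)"] order_trans[OF norm_proj_le(1) N[of n]] by simp
    then show "bounded (range (\<lambda>n. fst l - fst (u n)))" by (auto simp: bounded_iff)
    have "norm (snd l $ j - snd (u n) $ j) \<le> norm (snd l $ j) + N" for n
      using norm_triangle_ineq4[of "snd l $ j" "snd (u n) $ j"]
        order_trans[OF Finite_Cartesian_Product.norm_nth_le order_trans[OF norm_proj_le(2) N[of n]]]
      by (smt (verit))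
    then show "bounded (range (\<lambda>n. snd l $ j - snd (u n) $ j))" by (auto simp: bounded_iff)
  qed
  have F1: "(\<lambda>n. norm (C (fst l) - C (fst (u n)))) \<longlonglongrightarrow> 0"
  proof -
    have "(norm (C (fst l) - C (fst (u n))))\<^sup>2 \<le> W (F (u n) - F l) (F (u n) - F l)" for n
      unfolding W_diag using omega
      by (simp add: F_def norm_minus_commute sum_nonneg less_imp_le)
    then have "(\<lambda>n. (norm (C (fst l) - C (fst (u n))))\<^sup>2) \<longlonglongrightarrow> 0"
      by (intro real_tendsto_sandwich[OF _ _ tendsto_const Wlim]) auto
    from tendsto_real_sqrt[OF this] show ?thesis by simp
  qed
  have F2: "(\<lambda>n. norm (Dinv j (snd l $ j) - Dinv j (snd (u n) $ j))) \<longlonglongrightarrow> 0" for j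
  proof -
    have "(norm (Dinv j (snd l $ j) - Dinv j (snd (u n) $ j)))\<^sup>2
        \<le> W (F (u n) - F l) (F (u n) - F l) / \<omega> j" for n
    proof -
      have "\<omega> j * (norm (snd (F (u n) - F l) $ j))\<^sup>2
          \<le> (\<Sum>i\<in>UNIV. \<omega> i * (norm (snd (F (u n) - F l) $ i))\<^sup>2)"
        using omega by (intro member_le_sum) (auto simp: less_imp_le)
      also have "\<dots> \<le> W (F (u n) - F l) (F (u n) - F l)" unfolding W_diag by simp
      finally show ?thesis using omega[of j]
        by (simp add: F_def norm_minus_commute pos_le_divide_eq mult.commute)
    qed
    then have "(\<lambda>n. (norm (Dinv j (snd l $ j) - Dinv j (snd (u n) $ j)))\<^sup>2) \<longlonglongrightarrow> 0"
      by (intro real_tendsto_sandwich[OF _ _ tendsto_const tendsto_divide_zero[OF Wlim, of "\<omega> j"]]) auto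
    from tendsto_real_sqrt[OF this] show ?thesis by simp
  qed
  show thesis
  proof (rule that[OF l weak1 weak2])
    assume "uniformly_monotone_at (\<lambda>w. {C w}) (fst l)"
    then show "(\<lambda>n. fst (u n)) \<longlonglongrightarrow> fst l"
      by (rule uniformly_monotone_at_tendsto[where v = "\<lambda>n. C (fst (u n))" and u = "C (fst l)"])
        (simp_all add: bounded_inner_tendsto_0[OF bdd1 F1])
  next
    fix j assume "uniformly_monotone_at (inv_op (D j)) (snd l $ j)"
    then show "(\<lambda>n. snd (u n) $ j) \<longlonglongrightarrow> snd l $ j"
      by (rule uniformly_monotone_at_tendsto[where v = "\<lambda>n. Dinv j (snd (u n) $ j)" and u = "Dinv j (snd l $ j)"])
        (use uK l in \<open>simp_all add: bounded_inner_tendsto_0[OF bdd2 F2] K_iff inv_D\<close>)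
  qed
qed

end

section \<open>Convergence of the splitting algorithm\<close>

theorem theorem3p1:
  fixes z :: "'h::{real_inner,complete_space}"
    and \<omega> :: "'i::finite \<Rightarrow> real"
    and A :: "'h \<Rightarrow> 'h set" and C :: "'h \<Rightarrow> 'h" and \<mu> :: real
    and G :: "'i \<Rightarrow> 'g::{real_inner,complete_space} set"
    and r :: "'i \<Rightarrow> 'g"
    and B D :: "'i \<Rightarrow> 'g \<Rightarrow> 'g set" and \<nu> :: "'i \<Rightarrow> real"
    and L :: "'i \<Rightarrow> 'h \<Rightarrow> 'g"
    and \<tau> \<rho> \<epsilon> :: real and \<sigma> :: "'i \<Rightarrow> real"
    and lam :: "nat \<Rightarrow> real"
    and a1 a2 :: "nat \<Rightarrow> 'h" and b c :: "'i \<Rightarrow> nat \<Rightarrow> 'g"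
    and x p y :: "nat \<Rightarrow> 'h" and v q :: "nat \<Rightarrow> 'g ^ 'i"
  assumes omega: "\<And>i. 0 < \<omega> i \<and> \<omega> i \<le> 1" "(\<Sum>i\<in>UNIV. \<omega> i) = 1"
    and A: "maximally_monotone_on UNIV A"
    and C: "\<mu> > 0" "cocoercive \<mu> C"
    and G: "\<And>i. hilbert_subspace (G i)"
    and r: "\<And>i. r i \<in> G i"
    and B: "\<And>i. maximally_monotone_on (G i) (B i)"
    and D: "\<And>i. maximally_monotone_on (G i) (D i)"
           "\<And>i. \<nu> i > 0" "\<And>i. strongly_monotone (\<nu> i) (D i)"
    and L: "\<And>i. bounded_linear (L i)" "\<And>i. range (L i) \<subseteq> G i" "\<And>i. L i \<noteq> (\<lambda>_. 0)"
    and z: "z \<in> ran_op (primal_op A C \<omega> L B D r)"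
    and tau: "\<tau> > 0" and sigma: "\<And>i. \<sigma> i > 0"
    and rho: "\<rho> = Min (insert (inverse \<tau>) (range (\<lambda>i. inverse (\<sigma> i))))
                   * (1 - sqrt (\<tau> * (\<Sum>i\<in>UNIV. \<sigma> i * \<omega> i * (onorm (L i))\<^sup>2)))"
    and cond: "2 * \<rho> * Min (insert \<mu> (range \<nu>)) > 1"
    and eps: "0 < \<epsilon>" "\<epsilon> < 1"
    and lam: "\<And>n. \<epsilon> \<le> lam n \<and> lam n \<le> 1"
    and a1: "summable (\<lambda>n. norm (a1 n))"
    and a2: "summable (\<lambda>n. norm (a2 n))"
    and v0: "v 0 \<in> prod_space G"
    and b: "\<And>i n. b i n \<in> G i" "\<And>i. summable (\<lambda>n. norm (b i n))"
    and c: "\<And>i n. c i n \<in> G i" "\<And>i. summable (\<lambda>n. norm (c i n))"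
    and p: "\<And>n. p n =
              resolvent (scale_op \<tau> A)
                (x n - \<tau> *\<^sub>R ((\<Sum>i\<in>UNIV. \<omega> i *\<^sub>R adjoint (L i) (v n $ i)) + C (x n) + a1 n - z))
              + a2 n"
    and y: "\<And>n. y n = 2 *\<^sub>R p n - x n"
    and x: "\<And>n. x (Suc n) = x n + lam n *\<^sub>R (p n - x n)"
    and q: "\<And>n i. q n $ i =
              resolvent (scale_op (\<sigma> i) (inv_op (B i)))
                (v n $ i + \<sigma> i *\<^sub>R (L i (y n) - as_map (inv_op (D i)) (v n $ i) - c i n - r i))
              + b i n"
    and v: "\<And>n i. v (Suc n) $ i = v n $ i + lam n *\<^sub>R (q n $ i - v n $ i)"
  shows "\<exists>xbar vbar.
           xbar \<in> primal_solutions z A C \<omega> L B D r \<and>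
           vbar \<in> dual_solutions z A C G \<omega> L B D r \<and>
           (weakly_converges_in UNIV x xbar \<and> weakly_converges_in (prod_space G) v vbar) \<and>
           (uniformly_monotone_at (\<lambda>w. {C w}) xbar \<longrightarrow> x \<longlonglongrightarrow> xbar) \<and>
           (\<forall>j. uniformly_monotone_at (inv_op (D j)) (vbar $ j) \<longrightarrow> (\<lambda>n. v n $ j) \<longlonglongrightarrow> vbar $ j)"
proof -
  define \<beta> where "\<beta> = Min (insert \<mu> (range \<nu>))"
  define M where "M = Min (insert (inverse \<tau>) (range (\<lambda>i. inverse (\<sigma> i))))"
  define s where "s = sqrt (\<tau> * (\<Sum>i\<in>UNIV. \<sigma> i * \<omega> i * (onorm (L i))\<^sup>2))"
  have \<beta>: "\<beta> > 0" "\<beta> \<le> \<mu>" "\<beta> \<le> \<nu> i" for i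
  proof -
    show "\<beta> > 0" using C(1) D(2) by (auto simp: \<beta>_def)
    show "\<beta> \<le> \<mu>" "\<beta> \<le> \<nu> i" unfolding \<beta>_def by (intro Min_le; simp)+
  qed
  have M: "M > 0" "M \<le> inverse \<tau>" "M \<le> inverse (\<sigma> i)" for i
  proof -
    show "M > 0" using tau sigma by (auto simp: M_def)
    show "M \<le> inverse \<tau>" "M \<le> inverse (\<sigma> i)" unfolding M_def by (intro Min_le; simp)+
  qed
  have \<rho>: "\<rho> = M * (1 - s)" using rho by (simp add: M_def s_def)
  have beta: "2 * \<rho> * \<beta> > 1" using cond by (simp add: \<beta>_def)
  then have "0 < \<rho> * \<beta>" by linarith
  then have \<rho>0: "\<rho> > 0" using \<beta>(1) by (simp add: zero_less_mult_iff)
  then have s1: "s < 1" using M(1) by (simp add: \<rho> zero_less_mult_iff)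
  interpret primal_dual z \<omega> A C G r B D \<nu> L \<tau> s \<rho> \<beta> \<sigma>
  proof (rule primal_dual.intro)
    show "cocoercive \<beta> C" unfolding cocoercive_def
    proof (intro conjI allI \<beta>(1))
      fix x y
      have "\<beta> * (norm (C x - C y))\<^sup>2 \<le> \<mu> * (norm (C x - C y))\<^sup>2"
        using \<beta>(2) by (intro mult_right_mono) auto
      also have "\<dots> \<le> (x - y) \<bullet> (C x - C y)" using C(2) by (simp add: cocoercive_def)
      finally show "\<beta> * (norm (C x - C y))\<^sup>2 \<le> (x - y) \<bullet> (C x - C y)" .
    qed
    show "\<rho> \<le> inverse \<tau> * (1 - s)" "\<rho> \<le> inverse (\<sigma> i) * (1 - s)" for i
      unfolding \<rho> using M s1 by (auto intro: mult_right_mono)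
  qed (use omega(1) A G r B D L tau sigma \<beta> s1 \<rho>0 beta in \<open>simp_all add: s_def\<close>)
  have step: "u \<in> K \<Longrightarrow> u = (x n, v n) \<Longrightarrow> norm ((p n, q n) - T u)
      \<le> (\<tau> * norm (a1 n) + norm (a2 n)) + (\<Sum>i\<in>UNIV. \<sigma> i *
          (onorm (L i) * (2 * (\<tau> * norm (a1 n) + norm (a2 n))) + norm (c i n)) + norm (b i n))" for n u
    using p[of n] q[of n] c(1) y[of n]
    by (intro perturbed_step) (simp_all add: Ladj_def Dinv_def)
  define e where "e n = (\<tau> * norm (a1 n) + norm (a2 n)) + (\<Sum>i\<in>UNIV. \<sigma> i *
          (onorm (L i) * (2 * (\<tau> * norm (a1 n) + norm (a2 n))) + norm (c i n)) + norm (b i n))" for n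
  have e: "summable e" unfolding e_def
    by (intro summable_add summable_mult summable_sum a1 a2 b(2) c(2))
  define u where "u n = (x n, v n)" for n
  have uK: "u n \<in> K" for n
  proof (induction n)
    case 0
    then show ?case using v0 by (simp add: u_def K_def)
  next
    case (Suc n)
    have "q n $ i \<in> G i" for i
    proof -
      have "v n $ i \<in> G i" using Suc by (simp add: u_def K_iff)
      then have "v n $ i + \<sigma> i *\<^sub>R (L i (y n) - as_map (inv_op (D i)) (v n $ i) - c i n - r i) \<in> G i"
        using Dinv_mem[of "v n $ i" i] unfolding Dinv_def
        by (intro subspace_add[OF G_sub] subspace_scale[OF G_sub] subspace_diff[OF G_sub] L_mem c(1) r)
      then show ?thesis
        using resolvent_mem(2)[OF G maximally_monotone_inv[OF B] sigma] q[of n i]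
        by (simp add: subspace_add[OF G_sub] b(1))
    qed
    then have "v (Suc n) $ i \<in> G i" for i using Suc unfolding v
      by (intro subspace_add[OF G_sub] subspace_scale[OF G_sub] subspace_diff[OF G_sub]) (auto simp: u_def K_iff)
    then show ?case by (simp add: u_def K_iff)
  qed
  have err: "norm (u (Suc n) - (u n + lam n *\<^sub>R (T (u n) - u n))) \<le> e n" for n
  proof -
    have "v (Suc n) = v n + lam n *\<^sub>R (q n - v n)" by (simp add: vec_eq_iff v)
    then have "u (Suc n) = u n + lam n *\<^sub>R ((p n, q n) - u n)" by (simp add: u_def x)
    then have "u (Suc n) - (u n + lam n *\<^sub>R (T (u n) - u n)) = lam n *\<^sub>R ((p n, q n) - T (u n))"
      by (simp add: scaleR_diff_right)
    then have "norm (u (Suc n) - (u n + lam n *\<^sub>R (T (u n) - u n)))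
        = \<bar>lam n\<bar> * norm ((p n, q n) - T (u n))" by simp
    also have "\<dots> \<le> 1 * norm ((p n, q n) - T (u n))"
      using lam[of n] eps(1) by (intro mult_right_mono) auto
    also have "\<dots> \<le> e n" using step[OF uK u_def] by (simp add: e_def)
    finally show ?thesis .
  qed
  obtain u0 where u0: "u0 \<in> K" "T u0 = u0" by (rule fixed_point_exists[OF z])
  obtain l where l: "l \<in> K" "T l = l"
    "weakly_converges_in UNIV (\<lambda>n. fst (u n)) (fst l)"
    "weakly_converges_in (prod_space G) (\<lambda>n. snd (u n)) (snd l)"
    "uniformly_monotone_at (\<lambda>w. {C w}) (fst l) \<Longrightarrow> (\<lambda>n. fst (u n)) \<longlonglongrightarrow> fst l"
    "\<And>j. uniformly_monotone_at (inv_op (D j)) (snd l $ j) \<Longrightarrow> (\<lambda>n. snd (u n) $ j) \<longlonglongrightarrow> snd l $ j"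
    by (rule perturbed_iteration_converges[OF uK u0 err e eps(1) lam]) (rule that)
  show ?thesis
  proof (intro exI conjI allI impI)
    show "fst l \<in> primal_solutions z A C \<omega> L B D r" "snd l \<in> dual_solutions z A C G \<omega> L B D r"
      by (rule solutions_of_fixed_point[OF l(1,2)])+
  qed (use l(3-6) in \<open>simp_all add: u_def\<close>)
qed

end
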